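(* Let $K$ be a compact invariant subgroup of a topological group $G$. If the quotient group $G/K$ has a strong $\sigma$-lattice of open homomorphisms onto topological groups with a countable network, then $G$ also has a strong $\sigma$-lattice of open homomorphisms onto topological groups with a countable network. Likewise, if $G/K$ has a strong $\sigma$-lattice of open homomorphisms onto topological groups with a countable base, then $G$ also has a strong $\sigma$-lattice of open homomorphisms onto topological groups with a countable base.
   Context: All topological spaces and topological groups are Hausdorff. "Invariant subgroup" means normal subgroup. Homomorphisms in a lattice are continuous. Every mapping $p$ of a space $X$ in a family of mappings is regarded as a mapping onto its image $p(X)$. For continuous onto mappings $f\colon X\to Y$ and $g\colon X\to Z$ write $f\prec g$ if there is a continuous mapping $h\colon Y\to Z$ with $g=h\circ f$. A family $\mathcal{L}$ of continuous mappings of a space $X$ is a strong $\sigma$-lattice for $X$ if: (1) $\mathcal{L}$ generates the topology of $X$, i.e. for every open $U\subset X$ and $x\in U$ there are $p\in\mathcal{L}$ and an open set $V$ in $p(X)$ with $x\in p^{-1}(V)\subset U$; (2) every finite subfamily of $\mathcal{L}$ has a lower bound in $(\mathcal{L},\prec)$; (3) for every decreasing sequence $p_0\succ p_1\succ p_2\succ\cdots$ in $\mathcal{L}$, the diagonal product $p_\omega$ of $\{p_n:n\in\omega\}$ (regarded as a mapping onto its image) belongs to $\mathcal{L}$, and if a sequence $\{x_n:n\in\omega\}\subset X$ satisfies $p_k(x_n)=p_k(x_k)$ whenever $k<n$, then there exists $x\in X$ with $p_n(x)=p_n(x_n)$ for each $n\in\omega$. Mappings $p,p'$ with $p\prec p'\prec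 p$ are identified (so "$p_\omega\in\mathcal{L}$" means that some $p\in\mathcal{L}$ satisfies $p\prec p_\omega\prec p$); equivalently, (3) says that the limit of the inverse sequence of the spaces $p_n(X)$ is naturally homeomorphic to the image of an element of $\mathcal{L}$. *)

theory Defs
  imports "HOL-Analysis.Analysis" "HOL-Algebra.Coset"
begin

text \<open>
  Standing convention: all spaces and all topological groups are Hausdorff.
\<close>

locale topological_group = group G for G (structure) +
  fixes T :: "'a topology"
  assumes topspace_eq: "topspace T = carrier G"
    and Hausdorff: "Hausdorff_space T"
    and continuous_mult: "continuous_map (prod_topology T T) T (\<lambda>(x, y). x \<otimes> y)"
    and continuous_inv: "continuous_map T T (\<lambda>x. inv x)"

definition quotient_group_topology ::
  "('a, 'm) monoid_scheme \<Rightarrow> 'a topology \<Rightarrow> 'a set \<Rightarrow> 'a set topology" where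
  "quotient_group_topology G T K =
     topology (\<lambda>U. U \<subseteq> carrier (G Mod K) \<and> openin T {x \<in> carrier G. K #>\<^bsub>G\<^esub> x \<in> U})"

lemma openin_quotient_group_topology:
  assumes "topspace T = carrier G"
  shows "openin (quotient_group_topology G T K) U \<longleftrightarrow>
    U \<subseteq> carrier (G Mod K) \<and> openin T {x \<in> carrier G. K #>\<^bsub>G\<^esub> x \<in> U}"
proof -
  have "istopology (\<lambda>U. U \<subseteq> carrier (G Mod K) \<and> openin T {x \<in> carrier G. K #>\<^bsub>G\<^esub> x \<in> U})"
    unfolding istopology_def
  proof (intro conjI allI impI)
    fix S U
    assume S: "S \<subseteq> carrier (G Mod K) \<and> openin T {x \<in> carrier G. K #>\<^bsub>G\<^esub> x \<in> S}"
      and U: "U \<subseteq> carrier (G Mod K) \<and> openin T {x \<in> carrier G. K #>\<^bsub>G\<^esub> x \<in> U}"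
    show "S \<inter> U \<subseteq> carrier (G Mod K)"
      using S by blast
    have "{x \<in> carrier G. K #>\<^bsub>G\<^esub> x \<in> S \<inter> U} =
        {x \<in> carrier G. K #>\<^bsub>G\<^esub> x \<in> S} \<inter> {x \<in> carrier G. K #>\<^bsub>G\<^esub> x \<in> U}"
      by blast
    then show "openin T {x \<in> carrier G. K #>\<^bsub>G\<^esub> x \<in> S \<inter> U}"
      using S U by (simp add: openin_Int)
  next
    fix \<K>
    assume K: "\<forall>S\<in>\<K>. S \<subseteq> carrier (G Mod K) \<and> openin T {x \<in> carrier G. K #>\<^bsub>G\<^esub> x \<in> S}"
    then show "\<Union>\<K> \<subseteq> carrier (G Mod K)"
      by blast
    have "{x \<in> carrier G. K #>\<^bsub>G\<^esub> x \<in> \<Union>\<K>} = (\<Union>S\<in>\<K>. {x \<in> carrier G. K #>\<^bsub>G\<^esub> x \<in> S})"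
      by blast
    then show "openin T {x \<in> carrier G. K #>\<^bsub>G\<^esub> x \<in> \<Union>\<K>}"
      using K by auto
  qed
  then show ?thesis
    by (simp add: quotient_group_topology_def topology_inverse')
qed

lemma quotient_map_quotient_group_topology:
  assumes T: "topspace T = carrier G"
  shows "quotient_map T (quotient_group_topology G T K) (\<lambda>x. K #>\<^bsub>G\<^esub> x)"
proof -
  have img: "(\<lambda>x. K #>\<^bsub>G\<^esub> x) ` carrier G = carrier (G Mod K)"
    by (auto simp: FactGroup_def RCOSETS_def)
  have "{x \<in> carrier G. K #>\<^bsub>G\<^esub> x \<in> carrier (G Mod K)} = topspace T"
    using img T by blast
  then have "openin (quotient_group_topology G T K) (carrier (G Mod K))"
    by (simp add: openin_quotient_group_topology[OF T])
  then have "topspace (quotient_group_topology G T K) = carrier (G Mod K)"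
    using openin_quotient_group_topology[OF T] openin_subset
    by (metis openin_topspace subset_antisym)
  then show ?thesis
    using img T by (auto simp: quotient_map_def openin_quotient_group_topology[OF T])
qed

definition network :: "'a topology \<Rightarrow> 'a set set \<Rightarrow> bool" where
  "network X \<N> \<longleftrightarrow>
     (\<forall>N\<in>\<N>. N \<subseteq> topspace X) \<and>
     (\<forall>U x. openin X U \<and> x \<in> U \<longrightarrow> (\<exists>N\<in>\<N>. x \<in> N \<and> N \<subseteq> U))"

definition has_countable_network :: "'a topology \<Rightarrow> bool" where
  "has_countable_network X \<longleftrightarrow> (\<exists>\<N>. countable \<N> \<and> network X \<N>)"

text \<open>
  A mapping of a space \<open>X\<close> onto its image is a pair \<open>(p, Y)\<close> consisting of the function and
  the topology of the image \<open>p(X)\<close>. Values of \<open>p\<close> outside \<open>X\<close> are irrelevant. The images of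
  all members of a family are carried by subsets of one type \<open>'b\<close>.
\<close>

type_synonym ('a, 'b) mapping = "('a \<Rightarrow> 'b) \<times> 'b topology"

definition continuous_onto :: "'a topology \<Rightarrow> ('a, 'b) mapping \<Rightarrow> bool" where
  "continuous_onto X = (\<lambda>(p, Y).
     continuous_map X Y p \<and> p ` topspace X = topspace Y \<and> Hausdorff_space Y)"

text \<open>\<open>finer X f g\<close> is \<open>f \<prec> g\<close>: the mapping \<open>g\<close> factors continuously through \<open>f\<close>.\<close>

definition finer :: "'a topology \<Rightarrow> ('a, 'b) mapping \<Rightarrow> ('a, 'c) mapping \<Rightarrow> bool" where
  "finer X = (\<lambda>(f, Y) (g, Z).
     \<exists>h. continuous_map Y Z h \<and> (\<forall>x\<in>topspace X. g x = h (f x)))"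

definition diagonal_product ::
  "'a topology \<Rightarrow> (nat \<Rightarrow> ('a, 'b) mapping) \<Rightarrow> ('a, nat \<Rightarrow> 'b) mapping" where
  "diagonal_product X p =
     (let d = (\<lambda>x n. fst (p n) x)
      in (d, subtopology (product_topology (\<lambda>n. snd (p n)) UNIV) (d ` topspace X)))"

text \<open>
  In the last clause, mappings that are \<open>\<prec>\<close>-equivalent are identified, so the diagonal
  product (whose codomain type differs from that of the family) belongs to \<open>L\<close> iff it is
  equivalent to a member of \<open>L\<close>.
\<close>

definition strong_sigma_lattice :: "'a topology \<Rightarrow> ('a, 'b) mapping set \<Rightarrow> bool" where
  "strong_sigma_lattice X L \<longleftrightarrow>
     (\<forall>p\<in>L. continuous_onto X p) \<and>
     (\<forall>U x. openin X U \<and> x \<in> U \<longrightarrow>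
        (\<exists>(p, Y)\<in>L. \<exists>V. openin Y V \<and> x \<in> {z \<in> topspace X. p z \<in> V} \<and>
           {z \<in> topspace X. p z \<in> V} \<subseteq> U)) \<and>
     (\<forall>F. finite F \<and> F \<subseteq> L \<longrightarrow> (\<exists>q\<in>L. \<forall>p\<in>F. finer X q p)) \<and>
     (\<forall>p. (\<forall>n. p n \<in> L) \<and> (\<forall>n. finer X (p (Suc n)) (p n)) \<longrightarrow>
        (\<exists>q\<in>L. finer X q (diagonal_product X p) \<and> finer X (diagonal_product X p) q) \<and>
        (\<forall>x. (\<forall>n. x n \<in> topspace X) \<and> (\<forall>k n. k < n \<longrightarrow> fst (p k) (x n) = fst (p k) (x k)) \<longrightarrow>
           (\<exists>z\<in>topspace X. \<forall>n. fst (p n) z = fst (p n) (x n))))"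

text \<open>
  The group operation of the image is determined by the homomorphism, so it is not made part of
  the mapping.
\<close>

definition open_homomorphism_onto_group ::
  "('a, 'm) monoid_scheme \<Rightarrow> 'a topology \<Rightarrow> ('b topology \<Rightarrow> bool) \<Rightarrow> ('a, 'b) mapping \<Rightarrow> bool" where
  "open_homomorphism_onto_group G T P = (\<lambda>(p, Y).
     \<exists>H :: 'b monoid. topological_group H Y \<and> P Y \<and> p \<in> hom G H \<and>
       p ` carrier G = carrier H \<and> continuous_map T Y p \<and> open_map T Y p)"

definition strong_sigma_lattice_of_open_homs ::
  "('a, 'm) monoid_scheme \<Rightarrow> 'a topology \<Rightarrow> ('b topology \<Rightarrow> bool) \<Rightarrow> ('a, 'b) mapping set \<Rightarrow> bool" where
  "strong_sigma_lattice_of_open_homs G T P L \<longleftrightarrow>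
     strong_sigma_lattice T L \<and> (\<forall>p\<in>L. open_homomorphism_onto_group G T P p)"

end

theory Submission
  imports Defs
begin

text \<open>
  An open continuous homomorphism of \<open>G\<close> onto a Hausdorff group is equivalent to the quotient
  mapping by its kernel, a closed normal subgroup, and \<open>p \<prec> q\<close> means that the kernel of \<open>p\<close> lies
  in the kernel of \<open>q\<close>. A strong \<open>\<sigma>\<close>-lattice of such homomorphisms is therefore the same thing as a
  family of closed normal subgroups that is directed downwards, is closed under decreasing countable
  intersections with the right topology and completeness, and generates the topology. The predicate
  \<open>subgroup_lattice K b\<close> states this inside \<open>G\<close> for lattices on \<open>G/K\<close>, all of whose kernels are
  pulled back to subgroups containing \<open>K\<close>. The flag \<open>b\<close> selects between countable bases
  (\<open>True\<close>) and countable networks (\<open>False\<close>), so that one argument serves both halves of the theorem.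

  Given such a family \<open>\<H>\<close> for \<open>G/K\<close>, the family for \<open>G\<close> consists of all closed normal \<open>N\<close> with
  \<open>NK \<in> \<H>\<close> and \<open>G/N\<close> of countable type (\<open>compact_lift\<close>). Compactness of \<open>K\<close> acts through two facts.
  First, \<open>K\<close> may be taken out of decreasing intersections of closed sets: \<open>\<Inter> (D\<^sub>n K) = (\<Inter> D\<^sub>n) K\<close>
  (\<open>compact_set_mult_Inter\<close>). Second, if \<open>N = A \<inter> B\<close> and \<open>B \<subseteq> KN\<close>, then \<open>G/N\<close> embeds into
  \<open>G/A \<times> G/B\<close>: the projection \<open>G/N \<rightarrow> G/B\<close> has compact kernel, hence is perfect, and pairing a
  perfect mapping with a continuous one that separates its fibres gives an embedding
  (\<open>compact_extension_separation\<close>). This holds also if \<open>G/A\<close> carries a coarser group topology given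
  by a filter base with intersection \<open>A\<close>, and it transfers countable bases and networks to \<open>G/N\<close>.

  To see that the new family generates the topology, let \<open>U\<close> be a neighbourhood of the identity.
  The quotients by members of \<open>\<H>\<close> are covered by countably many translates of any neighbourhood, and
  with \<open>K\<close> compact the same is true of \<open>G\<close>. By an argument going back to Guran, \<open>U\<close> then belongs to a
  countable group filter base whose intersection \<open>A\<close> is a closed normal subgroup
  (\<open>narrow_normal_filter_base\<close>). Since \<open>A\<close> is a countable intersection of neighbourhoods of the
  identity, some \<open>H \<in> \<H>\<close> lies in \<open>AK\<close> (\<open>subgroup_lattice_below_G_delta\<close>), and \<open>N = A \<inter> H\<close> satisfies
  \<open>NK = H\<close>, so the second fact applies. Lower bounds of \<open>N\<^sub>1\<close> and \<open>N\<^sub>2\<close> are found in the same way as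
  \<open>N\<^sub>1 \<inter> N\<^sub>2 \<inter> H\<close> with \<open>H \<subseteq> (N\<^sub>1 \<inter> N\<^sub>2) K\<close>. For a decreasing sequence the first fact gives
  \<open>(\<Inter> N\<^sub>n) K = \<Inter> (N\<^sub>n K)\<close>; completeness follows from that of \<open>\<H>\<close> and compactness of the cosets
  of \<open>K\<close>, and the second fact identifies the topology of the limit.
\<close>

section \<open>Factorization of mappings and strong \<open>\<sigma>\<close>-lattices\<close>

text \<open>
  In this form \<open>f \<prec> g\<close> becomes an inclusion of kernels.
\<close>

lemma finer_fibres:
  assumes "finer X (f, Y) (g, Z)" "x \<in> topspace X" "y \<in> topspace X" "f x = f y"
  shows "g x = g y"
  using assms unfolding finer_def by auto

lemma finer_of_quotient_map:
  assumes f: "quotient_map X Y f" and g: "continuous_map X Z g"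
    and fib: "\<And>x y. x \<in> topspace X \<Longrightarrow> y \<in> topspace X \<Longrightarrow> f x = f y \<Longrightarrow> g x = g y"
  shows "finer X (f, Y) (g, Z)"
proof -
  obtain h where "continuous_map Y Z h" "h ` topspace Y = g ` topspace X" "\<And>x. x \<in> topspace X \<Longrightarrow> h (f x) = g x"
    using quotient_map_lift_exists[OF f g fib] by blast
  then show ?thesis unfolding finer_def by auto
qed

lemma strong_sigma_latticeD:
  assumes "strong_sigma_lattice X L"
  shows "openin X U \<Longrightarrow> x \<in> U \<Longrightarrow> \<exists>(p, Y)\<in>L. \<exists>V. openin Y V \<and> x \<in> {z \<in> topspace X. p z \<in> V} \<and>
           {z \<in> topspace X. p z \<in> V} \<subseteq> U"
    and "finite F \<Longrightarrow> F \<subseteq> L \<Longrightarrow> \<exists>q\<in>L. \<forall>p\<in>F. finer X q p"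
    and "(\<And>n. p n \<in> L) \<Longrightarrow> (\<And>n. finer X (p (Suc n)) (p n)) \<Longrightarrow>
        \<exists>q\<in>L. finer X q (diagonal_product X p) \<and> finer X (diagonal_product X p) q"
    and "(\<And>n. p n \<in> L) \<Longrightarrow> (\<And>n. finer X (p (Suc n)) (p n)) \<Longrightarrow>
        (\<And>n. x' n \<in> topspace X) \<Longrightarrow> (\<And>k n. k < n \<Longrightarrow> fst (p k) (x' n) = fst (p k) (x' k)) \<Longrightarrow>
           (\<exists>z\<in>topspace X. \<forall>n. fst (p n) z = fst (p n) (x' n))"
proof -
  note * = assms[unfolded strong_sigma_lattice_def]
  show "openin X U \<Longrightarrow> x \<in> U \<Longrightarrow> \<exists>(p, Y)\<in>L. \<exists>V. openin Y V \<and> x \<in> {z \<in> topspace X. p z \<in> V} \<and>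
           {z \<in> topspace X. p z \<in> V} \<subseteq> U"
    using *[THEN conjunct2, THEN conjunct1] by simp
  show "finite F \<Longrightarrow> F \<subseteq> L \<Longrightarrow> \<exists>q\<in>L. \<forall>p\<in>F. finer X q p"
    using *[THEN conjunct2, THEN conjunct2, THEN conjunct1] by simp
  note seq = *[THEN conjunct2, THEN conjunct2, THEN conjunct2, rule_format, of p]
  show "(\<And>n. p n \<in> L) \<Longrightarrow> (\<And>n. finer X (p (Suc n)) (p n)) \<Longrightarrow>
        \<exists>q\<in>L. finer X q (diagonal_product X p) \<and> finer X (diagonal_product X p) q"
    using seq by simp
  show "(\<And>n. p n \<in> L) \<Longrightarrow> (\<And>n. finer X (p (Suc n)) (p n)) \<Longrightarrow>
        (\<And>n. x' n \<in> topspace X) \<Longrightarrow> (\<And>k n. k < n \<Longrightarrow> fst (p k) (x' n) = fst (p k) (x' k)) \<Longrightarrow>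
           (\<exists>z\<in>topspace X. \<forall>n. fst (p n) z = fst (p n) (x' n))"
    using seq by simp
qed

text \<open>
  A base is a network of open sets, so the flag \<open>b\<close> lets countable networks and countable bases be
  treated together.
\<close>

definition countable_network_by :: "bool \<Rightarrow> 'b topology \<Rightarrow> bool" where
  "countable_network_by b Y \<longleftrightarrow>
     (\<exists>\<N>. countable \<N> \<and> network Y \<N> \<and> (b \<longrightarrow> (\<forall>N\<in>\<N>. openin Y N)))"

lemma countable_network_by_False: "countable_network_by False = has_countable_network"
  by (auto simp: countable_network_by_def has_countable_network_def fun_eq_iff)

lemma countable_network_by_True: "countable_network_by True = second_countable"
proof
  fix X :: "'b topology"
  have "(countable \<N> \<and> network X \<N> \<and> (True \<longrightarrow> (\<forall>N\<in>\<N>. openin X N))) =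
    (countable \<N> \<and> (\<forall>V\<in>\<N>. openin X V) \<and>
      (\<forall>U x. openin X U \<and> x \<in> U \<longrightarrow> (\<exists>V\<in>\<N>. x \<in> V \<and> V \<subseteq> U)))" for \<N>
    unfolding network_def using openin_subset[of X] by (intro iffI conjI) simp_all
  then show "countable_network_by True X = second_countable X"
    unfolding countable_network_by_def second_countable_def by simp
qed

text \<open>
  The union of all stages is the least family containing \<open>U\<close> that is closed under binary
  intersections and contains \<open>g V\<close> for each of its members \<open>V\<close>. Building it in stages makes it
  visibly countable.
\<close>

primrec refinements :: "('a set \<Rightarrow> 'a set set) \<Rightarrow> 'a set \<Rightarrow> nat \<Rightarrow> 'a set set" where
  "refinements g U 0 = {U}"
| "refinements g U (Suc n) = refinements g U n \<union> (\<Union>V\<in>refinements g U n. g V) \<union>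
     (\<lambda>(V, W). V \<inter> W) ` (refinements g U n \<times> refinements g U n)"

lemma countable_refinements:
  assumes "\<And>V. countable (g V)" shows "countable (refinements g U n)"
  by (induction n) (auto intro!: countable_UN countable_image countable_SIGMA assms)

lemma refinements_mono: "m \<le> n \<Longrightarrow> refinements g U m \<subseteq> refinements g U n"
  by (rule lift_Suc_mono_le) auto

context topological_group
begin

section \<open>Neighbourhoods of the identity\<close>

definition unit_nhd :: "'a set \<Rightarrow> bool" where
  "unit_nhd W \<longleftrightarrow> openin T W \<and> \<one> \<in> W"

lemma open_subset_carrier: "openin T W \<Longrightarrow> W \<subseteq> carrier G"
  using openin_subset topspace_eq by metis

lemma unit_nhd_subset: "unit_nhd W \<Longrightarrow> W \<subseteq> carrier G"
  by (simp add: unit_nhd_def open_subset_carrier)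

lemma unit_nhd_carrier: "unit_nhd (carrier G)"
  unfolding unit_nhd_def using openin_topspace[of T] topspace_eq by simp

lemma unit_nhd_Int: "unit_nhd V \<Longrightarrow> unit_nhd W \<Longrightarrow> unit_nhd (V \<inter> W)"
  by (auto simp: unit_nhd_def)

lemma continuous_map_left_mult:
  assumes "a \<in> carrier G"
  shows "continuous_map T T (\<lambda>x. a \<otimes> x)"
proof -
  have "continuous_map T (prod_topology T T) (\<lambda>x. (a, x))"
    using assms topspace_eq by (simp add: continuous_map_pairwise o_def)
  then show ?thesis
    using continuous_map_compose[OF _ continuous_mult] by (force simp: o_def)
qed

lemma continuous_map_right_mult:
  assumes "a \<in> carrier G"
  shows "continuous_map T T (\<lambda>x. x \<otimes> a)"
proof -
  have "continuous_map T (prod_topology T T) (\<lambda>x. (x, a))"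
    using assms topspace_eq by (simp add: continuous_map_pairwise o_def)
  then show ?thesis
    using continuous_map_compose[OF _ continuous_mult] by (force simp: o_def)
qed

lemma open_preimage:
  assumes "continuous_map T T f" "openin T U"
  shows "openin T {x \<in> carrier G. f x \<in> U}"
  using openin_continuous_map_preimage[OF assms] topspace_eq by simp

lemma closed_preimage:
  assumes "continuous_map T T f" "closedin T U"
  shows "closedin T {x \<in> carrier G. f x \<in> U}"
  using closedin_continuous_map_preimage[OF assms] topspace_eq by simp

lemma open_set_mult:
  assumes "openin T W" "A \<subseteq> carrier G"
  shows "openin T (W <#> A)"
proof -
  have "W <#> A = (\<Union>a\<in>A. {x \<in> carrier G. x \<otimes> inv a \<in> W})"
    using assms open_subset_carrier[OF assms(1)]
    unfolding set_mult_def
    by (fastforce simp: subset_iff inv_solve_right m_assoc)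
  moreover have "openin T {x \<in> carrier G. x \<otimes> inv a \<in> W}" if "a \<in> A" for a
    using that assms by (intro open_preimage continuous_map_right_mult) auto
  ultimately show ?thesis by auto
qed

lemma open_left_translate:
  assumes "openin T W" "a \<in> carrier G"
  shows "openin T {x \<in> carrier G. inv a \<otimes> x \<in> W}"
  using assms by (intro open_preimage continuous_map_left_mult) auto

lemma unit_nhd_set_mult:
  assumes "unit_nhd W" "subgroup A G"
  shows "unit_nhd (W <#> A)"
proof -
  have "\<one> \<in> W <#> A"
    using assms subgroup.one_closed[OF assms(2)] unfolding unit_nhd_def set_mult_def
    by (force intro!: bexI[of _ "\<one>"])
  then show ?thesis
    using assms open_set_mult[OF _ subgroup.subset[OF assms(2)]] by (simp add: unit_nhd_def)
qed

text \<open>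
  Continuity of multiplication and inversion at the identity, in the form \<open>W = W\<inverse>\<close>, \<open>WW \<subseteq> U\<close>.
\<close>

lemma unit_nhd_symmetric_root:
  assumes "unit_nhd U"
  obtains W where "unit_nhd W" "W \<subseteq> U" "\<And>x. x \<in> W \<Longrightarrow> inv x \<in> W"
    "\<And>x y. x \<in> W \<Longrightarrow> y \<in> W \<Longrightarrow> x \<otimes> y \<in> U"
proof -
  have "openin (prod_topology T T) {z \<in> topspace (prod_topology T T). (case z of (x, y) \<Rightarrow> x \<otimes> y) \<in> U}"
    using openin_continuous_map_preimage[OF continuous_mult] assms unit_nhd_def by blast
  moreover have "(\<one>, \<one>) \<in> {z \<in> topspace (prod_topology T T). (case z of (x, y) \<Rightarrow> x \<otimes> y) \<in> U}"
    using assms by (simp add: unit_nhd_def topspace_eq)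
  ultimately obtain V V' where V: "openin T V" "openin T V'" "\<one> \<in> V" "\<one> \<in> V'"
    "V \<times> V' \<subseteq> {z \<in> topspace (prod_topology T T). (case z of (x, y) \<Rightarrow> x \<otimes> y) \<in> U}"
    unfolding openin_prod_topology_alt by meson
  define V2 where "V2 = V \<inter> V' \<inter> U"
  define W where "W = V2 \<inter> {x \<in> carrier G. inv x \<in> V2}"
  have V2: "unit_nhd V2"
    using V assms by (auto simp: V2_def unit_nhd_def)
  show thesis
  proof
    show "unit_nhd W"
      using V2 open_preimage[OF continuous_inv, of V2] by (auto simp: W_def unit_nhd_def)
    show "W \<subseteq> U" by (auto simp: W_def V2_def)
    show "inv x \<in> W" if "x \<in> W" for x
      using that by (auto simp: W_def)
    show "x \<otimes> y \<in> U" if "x \<in> W" "y \<in> W" for x y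
    proof -
      have "(x, y) \<in> V \<times> V'"
        using that by (auto simp: W_def V2_def)
      then show ?thesis using V(5) by auto
    qed
  qed
qed

lemma unit_nhd_tube:
  assumes C: "compactin T C" and O: "openin T Q" and sub: "C \<subseteq> Q"
  obtains W where "unit_nhd W" "W <#> C \<subseteq> Q"
proof -
  let ?P = "{z \<in> topspace (prod_topology T T). (case z of (x, y) \<Rightarrow> x \<otimes> y) \<in> Q}"
  have one: "compactin T {\<one>}"
    by (simp add: topspace_eq)
  have P: "openin (prod_topology T T) ?P"
    using openin_continuous_map_preimage[OF continuous_mult O] .
  have "{\<one>} \<times> C \<subseteq> ?P"
    using sub open_subset_carrier[OF O] topspace_eq by (auto simp: subset_iff)
  from Wallace_theorem_prod_topology[OF one C P this]
  obtain U V where "openin T U" "openin T V" "{\<one>} \<subseteq> U" "C \<subseteq> V" "U \<times> V \<subseteq> ?P" .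
  then have "unit_nhd U" "U <#> C \<subseteq> Q"
    by (auto simp: unit_nhd_def set_mult_def subset_iff)
  then show thesis using that by blast
qed

text \<open>
  A compact factor can be taken out of a decreasing intersection of closed sets: the possible second
  factors \<open>k\<close> of \<open>x\<close> with \<open>x k\<inverse> \<in> D n\<close> form decreasing nonempty closed subsets of \<open>K\<close>, and
  a common element of them works for all \<open>n\<close> at once.
\<close>

lemma compact_set_mult_Inter:
  assumes K: "compactin T K" and D: "\<And>n. closedin T (D n)" "decseq D"
    and x: "\<And>n. x \<in> D n <#> K"
  shows "x \<in> (\<Inter>n. D n) <#> K"
proof -
  have Kc: "K \<subseteq> carrier G" using compactin_subset_topspace[OF K] topspace_eq by simp
  have Dc: "D n \<subseteq> carrier G" for n using closedin_subset[OF D(1)] topspace_eq by simp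
  have xc: "x \<in> carrier G" using x[of 0] Dc[of 0] Kc unfolding set_mult_def by fastforce
  define C where "C n = K \<inter> {k \<in> carrier G. x \<otimes> inv k \<in> D n}" for n
  have cm: "continuous_map T T (\<lambda>k. x \<otimes> inv k)"
    using continuous_map_compose[OF continuous_inv continuous_map_left_mult[OF xc]] by (simp add: o_def)
  have "closedin (subtopology T K) (C n)" for n
    unfolding C_def using closed_preimage[OF cm D(1)] by (simp add: closedin_subtopology_Int_closed)
  moreover have "C n \<noteq> {}" for n
  proof -
    obtain d k where "d \<in> D n" "k \<in> K" "x = d \<otimes> k"
      using x[of n] unfolding set_mult_def by blast
    then have "k \<in> C n"
      using Kc Dc[of n] by (auto simp: C_def m_assoc subset_iff)
    then show ?thesis by blast
  qed
  moreover have "decseq C"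
    using D(2) unfolding decseq_def C_def by blast
  moreover have "compact_space (subtopology T K)"
    using K by (simp add: compact_space_subtopology)
  ultimately have "(\<Inter>n. C n) \<noteq> {}"
    by (intro compact_space_imp_nest)
  then obtain k where k: "\<And>n. k \<in> C n" by blast
  then have "k \<in> K" "x \<otimes> inv k \<in> (\<Inter>n. D n)" by (auto simp: C_def)
  moreover have "x = (x \<otimes> inv k) \<otimes> k"
    using xc k[of 0] by (simp add: C_def m_assoc)
  ultimately show ?thesis unfolding set_mult_def by blast
qed

lemma inv_cancel_left: "x \<in> carrier G \<Longrightarrow> z \<in> carrier G \<Longrightarrow> inv x \<otimes> (x \<otimes> z) = z"
  by (simp add: m_assoc[symmetric])

lemma inv_cancel_right: "x \<in> carrier G \<Longrightarrow> z \<in> carrier G \<Longrightarrow> x \<otimes> (inv x \<otimes> z) = z"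
  by (simp add: m_assoc[symmetric])

lemmas group_simps = m_assoc inv_mult_group inv_cancel_left inv_cancel_right

lemma mem_l_coset_iff:
  assumes "V \<subseteq> carrier G" "x \<in> carrier G"
  shows "y \<in> x <# V \<longleftrightarrow> y \<in> carrier G \<and> inv x \<otimes> y \<in> V"
  using assms unfolding l_coset_def by (force simp: group_simps subset_iff)

lemma open_l_coset:
  assumes "openin T W" "a \<in> carrier G"
  shows "openin T (a <# W)"
proof -
  have "a <# W = {x \<in> carrier G. inv a \<otimes> x \<in> W}"
    using mem_l_coset_iff[OF open_subset_carrier[OF assms(1)] assms(2)] by blast
  then show ?thesis using open_left_translate[OF assms] by simp
qed

lemma set_mult_memI: "x \<in> A \<Longrightarrow> y \<in> B \<Longrightarrow> x \<otimes> y \<in> A <#> B"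
  unfolding set_mult_def by blast

lemma set_mult_memE:
  assumes "z \<in> A <#> B" obtains x y where "x \<in> A" "y \<in> B" "z = x \<otimes> y"
  using assms unfolding set_mult_def by blast

lemma set_mult_right_mono: "A \<subseteq> B \<Longrightarrow> C <#> A \<subseteq> C <#> B"
  by (rule mono_set_mult) simp_all

lemma set_mult_left_mono: "A \<subseteq> B \<Longrightarrow> A <#> C \<subseteq> B <#> C"
  by (rule mono_set_mult) simp_all

lemma subset_set_mult_right:
  assumes "\<one> \<in> A" "B \<subseteq> carrier G" shows "B \<subseteq> A <#> B"
proof
  fix b assume "b \<in> B"
  then show "b \<in> A <#> B" using set_mult_memI[OF assms(1), of b B] assms(2) by auto
qed

lemma subset_set_mult_left:
  assumes "\<one> \<in> B" "A \<subseteq> carrier G" shows "A \<subseteq> A <#> B"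
proof
  fix b assume "b \<in> A"
  then show "b \<in> A <#> B" using set_mult_memI[OF _ assms(1), of b A] assms(2) by auto
qed

text \<open>
  Regularity of topological groups: a point of the closure of \<open>W\<close> has a translate of \<open>W\<close> meeting \<open>W\<close>.
\<close>

lemma closure_of_root_subset:
  assumes W: "unit_nhd W" "\<And>x y. x \<in> W \<Longrightarrow> y \<in> W \<Longrightarrow> x \<otimes> inv y \<in> U"
  shows "T closure_of W \<subseteq> U"
proof
  fix x assume x: "x \<in> T closure_of W"
  then have xc: "x \<in> carrier G" using in_closure_of topspace_eq by metis
  have Wc: "W \<subseteq> carrier G" using W(1) unit_nhd_subset by blast
  have "openin T (x <# W)" using W(1) xc open_l_coset by (simp add: unit_nhd_def)
  moreover have "x \<in> x <# W"
    using mem_l_coset_iff[OF Wc xc] xc W(1) by (simp add: unit_nhd_def)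
  ultimately obtain y where y: "y \<in> W" "y \<in> x <# W"
    using x unfolding in_closure_of by blast
  then have "inv x \<otimes> y \<in> W" using mem_l_coset_iff[OF Wc xc] by blast
  then have "y \<otimes> inv (inv x \<otimes> y) \<in> U" using W(2) y(1) by blast
  moreover have "y \<otimes> inv (inv x \<otimes> y) = x"
    using xc y(1) Wc by (simp add: group_simps subset_iff)
  ultimately show "x \<in> U" by simp
qed

text \<open>
  A closed set \<open>N\<close> is the intersection of the sets \<open>WN\<close>: if \<open>x\<close> is outside \<open>N\<close>, so is \<open>w\<inverse> x\<close> for all \<open>w\<close>
  near the identity.
\<close>

lemma closed_subgroup_memI:
  assumes N: "closedin T N" "x \<in> carrier G" and x: "\<And>W. unit_nhd W \<Longrightarrow> x \<in> W <#> N"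
  shows "x \<in> N"
proof (rule ccontr)
  assume "x \<notin> N"
  let ?W = "{w \<in> carrier G. inv w \<otimes> x \<in> carrier G - N}"
  have "continuous_map T T (\<lambda>w. inv w \<otimes> x)"
    using continuous_map_compose[OF continuous_inv continuous_map_right_mult[OF N(2)]] by (simp add: o_def)
  then have "openin T ?W"
    using N(1) topspace_eq by (intro open_preimage) (auto simp: closedin_def)
  then have "unit_nhd ?W" using N(2) \<open>x \<notin> N\<close> by (simp add: unit_nhd_def)
  from x[OF this] obtain w n where wn: "w \<in> ?W" "n \<in> N" "x = w \<otimes> n"
    by (rule set_mult_memE)
  then have "inv w \<otimes> x = n"
    using closedin_subset[OF N(1)] topspace_eq by (auto simp: group_simps subset_iff)
  then show False using wn by auto
qed

section \<open>Group filter bases and compact separation\<close>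

text \<open>
  Such a family is a neighbourhood base of the identity for a possibly coarser, possibly
  non-Hausdorff uniformity on \<open>G\<close>; its intersection plays the role of a kernel.
\<close>

definition group_filter_base :: "'a set set \<Rightarrow> bool" where
  "group_filter_base \<gamma> \<longleftrightarrow> \<gamma> \<noteq> {} \<and> (\<forall>V\<in>\<gamma>. unit_nhd V) \<and>
     (\<forall>V\<in>\<gamma>. \<forall>W\<in>\<gamma>. \<exists>U\<in>\<gamma>. U \<subseteq> V \<inter> W) \<and>
     (\<forall>V\<in>\<gamma>. \<exists>W\<in>\<gamma>. \<forall>x\<in>W. \<forall>y\<in>W. x \<otimes> inv y \<in> V)"

lemma group_filter_base_finite:
  assumes "group_filter_base \<gamma>" "finite F" "F \<subseteq> \<gamma>"
  obtains V where "V \<in> \<gamma>" "V \<subseteq> \<Inter>F"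
proof -
  have "\<exists>V\<in>\<gamma>. V \<subseteq> \<Inter>F"
    using assms(2,3)
  proof (induction F)
    case empty
    then show ?case using assms(1) by (auto simp: group_filter_base_def)
  next
    case (insert A F)
    then obtain V where V: "V \<in> \<gamma>" "V \<subseteq> \<Inter>F" by auto
    then obtain U where "U \<in> \<gamma>" "U \<subseteq> A \<inter> V"
      using assms(1) insert.prems unfolding group_filter_base_def by (meson insert_subset)
    then show ?case using V by blast
  qed
  then show thesis using that by blast
qed

lemma group_filter_base_root:
  assumes \<gamma>: "group_filter_base \<gamma>" and V: "V \<in> \<gamma>"
  obtains W where "W \<in> \<gamma>" "W \<subseteq> V" "\<And>x y z. x \<in> W \<Longrightarrow> y \<in> W \<Longrightarrow> z \<in> W \<Longrightarrow> inv x \<otimes> (y \<otimes> z) \<in> V"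
proof -
  have root: "\<exists>W\<in>\<gamma>. \<forall>x\<in>W. \<forall>y\<in>W. x \<otimes> inv y \<in> V" if "V \<in> \<gamma>" for V
    using \<gamma> that by (auto simp: group_filter_base_def)
  have nhd: "unit_nhd V" if "V \<in> \<gamma>" for V
    using \<gamma> that by (auto simp: group_filter_base_def)
  obtain V1 where V1: "V1 \<in> \<gamma>" "\<And>x y. x \<in> V1 \<Longrightarrow> y \<in> V1 \<Longrightarrow> x \<otimes> inv y \<in> V"
    using root[OF V] by blast
  obtain V2 where V2: "V2 \<in> \<gamma>" "\<And>x y. x \<in> V2 \<Longrightarrow> y \<in> V2 \<Longrightarrow> x \<otimes> inv y \<in> V1"
    using root[OF V1(1)] by blast
  obtain V3 where V3: "V3 \<in> \<gamma>" "\<And>x y. x \<in> V3 \<Longrightarrow> y \<in> V3 \<Longrightarrow> x \<otimes> inv y \<in> V2"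
    using root[OF V2(1)] by blast
  have inv3: "inv x \<in> V2" if "x \<in> V3" for x
    using V3(2)[of "\<one>" x] that nhd[OF V3(1)] unit_nhd_subset[OF nhd[OF V3(1)]]
    by (auto simp: unit_nhd_def subset_iff)
  have sub3: "V3 \<subseteq> V2"
    using V3(2)[of _ "\<one>"] nhd[OF V3(1)] unit_nhd_subset[OF nhd[OF V3(1)]]
    by (auto simp: unit_nhd_def subset_iff)
  have sub2: "V2 \<subseteq> V1"
    using V2(2)[of _ "\<one>"] nhd[OF V2(1)] unit_nhd_subset[OF nhd[OF V2(1)]]
    by (auto simp: unit_nhd_def subset_iff)
  have sub1: "V1 \<subseteq> V"
    using V1(2)[of _ "\<one>"] nhd[OF V1(1)] unit_nhd_subset[OF nhd[OF V1(1)]]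
    by (auto simp: unit_nhd_def subset_iff)
  show thesis
  proof
    show "V3 \<in> \<gamma>" "V3 \<subseteq> V" using V3 sub1 sub2 sub3 by auto
    fix x y z assume xyz: "x \<in> V3" "y \<in> V3" "z \<in> V3"
    have c: "x \<in> carrier G" "y \<in> carrier G" "z \<in> carrier G"
      using xyz unit_nhd_subset[OF nhd[OF V3(1)]] by auto
    have 1: "inv x \<otimes> inv (inv y) \<in> V1"
      using V2(2) inv3 xyz by blast
    have 2: "inv z \<in> V1"
      using inv3 xyz sub2 by blast
    have "(inv x \<otimes> y) \<otimes> z \<in> V"
      using V1(2)[OF 1 2] c by simp
    then show "inv x \<otimes> (y \<otimes> z) \<in> V" using c by (simp add: m_assoc)
  qed
qed

text \<open>
  The compactness argument behind the embedding of \<open>G/N\<close> into a product. The points of \<open>C\<close> outside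
  \<open>U\<close> are not in \<open>\<Inter>\<gamma>\<close>, so each has a neighbourhood that misses \<open>VN\<close> for some \<open>V \<in> \<gamma>\<close>.
  By compactness one \<open>V\<close> serves an open set \<open>Q'\<close> containing all of them, and \<open>WC\<close> stays for small \<open>W\<close>
  in \<open>U \<union> Q'\<close>. A point of \<open>WCN \<inter> V\<close> cannot come from \<open>Q'\<close>, so it lies in \<open>UN = U\<close>.
\<close>

lemma compact_separation:
  assumes \<gamma>: "group_filter_base \<gamma>" and C: "compactin T C" and N: "subgroup N G" "N \<subseteq> \<Inter>\<gamma>"
    and U: "openin T U" "U <#> N \<subseteq> U" and CU: "C \<inter> \<Inter>\<gamma> \<subseteq> U"
  obtains W V where "unit_nhd W" "V \<in> \<gamma>" "(W <#> C <#> N) \<inter> V \<subseteq> U"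
proof -
  have Nc: "N \<subseteq> carrier G" using N(1) subgroup.subset by blast
  have nhd: "unit_nhd V" if "V \<in> \<gamma>" for V
    using \<gamma> that by (auto simp: group_filter_base_def)
  define F where "F = C - U"
  have Fc: "F \<subseteq> carrier G" using compactin_subset_topspace[OF C] topspace_eq by (auto simp: F_def)
  have F: "compactin T F"
    unfolding F_def using closed_Int_compactin[of T "topspace T - U" C] C U(1) compactin_subset_topspace[OF C]
    by (metis Int_Diff Int_absorb1 Int_commute closedin_diff closedin_topspace)
  \<comment> \<open>The neighbourhood \<open>Vf\<close> of \<open>f\<close> is disjoint from \<open>VN\<close>; both are controlled by the same \<open>V\<close>.\<close>
  have "\<exists>V\<in>\<gamma>. \<forall>v\<in>V. \<forall>w\<in>V. \<forall>n\<in>N. v \<otimes> f \<noteq> w \<otimes> n" if f: "f \<in> F" for f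
  proof -
    obtain V where V: "V \<in> \<gamma>" "f \<notin> V" using f CU by (auto simp: F_def)
    obtain W where W: "W \<in> \<gamma>" "\<And>x y z. x \<in> W \<Longrightarrow> y \<in> W \<Longrightarrow> z \<in> W \<Longrightarrow> inv x \<otimes> (y \<otimes> z) \<in> V"
      using group_filter_base_root[OF \<gamma> V(1)] by metis
    have "v \<otimes> f \<noteq> w \<otimes> n" if "v \<in> W" "w \<in> W" "n \<in> N" for v w n
    proof
      assume eq: "v \<otimes> f = w \<otimes> n"
      \<comment> \<open>As \<open>n\<close> lies in \<open>W\<close> too, \<open>f = v\<inverse> w n\<close> would be in \<open>V\<close>.\<close>
      have "n \<in> W" using that N(2) W(1) by blast
      then have "inv v \<otimes> (w \<otimes> n) \<in> V" using W(2) that by blast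
      moreover have "inv v \<otimes> (v \<otimes> f) = f"
        using that unit_nhd_subset[OF nhd[OF W(1)]] f Fc by (simp add: m_assoc[symmetric] subset_iff)
      ultimately show False using eq V(2) by simp
    qed
    then show ?thesis using W(1) by blast
  qed
  then obtain v where v: "\<And>f. f \<in> F \<Longrightarrow> v f \<in> \<gamma>"
    "\<And>f a b n. f \<in> F \<Longrightarrow> a \<in> v f \<Longrightarrow> b \<in> v f \<Longrightarrow> n \<in> N \<Longrightarrow> a \<otimes> f \<noteq> b \<otimes> n"
    by metis
  have opvF: "openin T (v f <#> {f})" if "f \<in> F" for f
    using open_set_mult nhd[OF v(1)[OF that]] that Fc by (auto simp: unit_nhd_def)
  have "\<exists>\<F>. finite \<F> \<and> \<F> \<subseteq> (\<lambda>f. v f <#> {f}) ` F \<and> F \<subseteq> \<Union>\<F>"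
  proof -
    have "f \<in> v f <#> {f}" if "f \<in> F" for f
      using nhd[OF v(1)[OF that]] that Fc by (force simp: unit_nhd_def set_mult_def)
    then have "\<forall>U\<in>(\<lambda>f. v f <#> {f}) ` F. openin T U" "F \<subseteq> \<Union>((\<lambda>f. v f <#> {f}) ` F)"
      using opvF by blast+
    then show ?thesis
      using F unfolding compactin_def by meson
  qed
  then obtain \<F> where \<F>: "finite \<F>" "\<F> \<subseteq> (\<lambda>f. v f <#> {f}) ` F" "F \<subseteq> \<Union>\<F>"
    by blast
  obtain F' where F': "F' \<subseteq> F" "finite F'" "\<F> = (\<lambda>f. v f <#> {f}) ` F'"
    using finite_subset_image[OF \<F>(1,2)] by blast
  have FF': "F \<subseteq> (\<Union>f\<in>F'. v f <#> {f})"
    using \<F>(3) F'(3) by simp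
  have opF: "openin T (v f <#> {f})" if "f \<in> F'" for f
    using that F'(1) opvF by blast
  obtain V where V: "V \<in> \<gamma>" "V \<subseteq> \<Inter>(v ` F')"
    using group_filter_base_finite[OF \<gamma>, of "v ` F'"] F'(1,2) v(1) by (metis finite_imageI image_subset_iff subsetD)
  define Q where "Q = U \<union> (\<Union>f\<in>F'. v f <#> {f})"
  have "openin T Q" unfolding Q_def using U opF by blast
  moreover have "C \<subseteq> Q" using FF' by (auto simp: Q_def F_def)
  ultimately obtain W where W: "unit_nhd W" "W <#> C \<subseteq> Q"
    using unit_nhd_tube[OF C] by blast
  have "(W <#> C <#> N) \<inter> V \<subseteq> U"
  proof
    fix x assume x: "x \<in> (W <#> C <#> N) \<inter> V"
    then obtain q n where qn: "q \<in> Q" "n \<in> N" "x = q \<otimes> n"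
      using W(2) unfolding set_mult_def by blast
    show "x \<in> U"
    proof (cases "q \<in> U")
      case True
      then show ?thesis using qn U(2) unfolding set_mult_def by blast
    next
      case False
      then obtain f a where f: "f \<in> F'" "a \<in> v f" "q = a \<otimes> f"
        using qn unfolding Q_def set_mult_def by blast
      have c: "q \<in> carrier G" "n \<in> carrier G"
        using f qn Nc Fc F'(1) unit_nhd_subset[OF nhd[OF v(1)]] by (auto simp: subset_iff)
      have "x \<in> v f" using x V f by blast
      moreover have "q = x \<otimes> inv n" using qn(3) c by (simp add: m_assoc)
      moreover have "inv n \<in> N" using N(1) qn(2) subgroup.m_inv_closed by metis
      moreover have "f \<in> F" using f(1) F'(1) by blast
      ultimately show ?thesis using v(2)[of f a x "inv n"] f(2,3) by metis
    qed
  qed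
  then show thesis using that W(1) V(1) by blast
qed

section \<open>Quotients of countable type\<close>

text \<open>
  The preimages in \<open>G\<close> of the neighbourhoods \<open>WN/N\<close> of the identity of \<open>G/N\<close>.
\<close>

definition quotient_base :: "'a set \<Rightarrow> 'a set set" where
  "quotient_base N = {W <#> N | W. unit_nhd W}"

text \<open>
  With \<open>\<gamma> = quotient_base N\<close> this says that \<open>G/N\<close> has a countable network, and a countable base if
  \<open>b\<close> holds; the witnesses are sets in \<open>G\<close>, which need not be saturated. Stating it for arbitrary
  \<open>\<gamma>\<close> covers topologies on quotients of \<open>G\<close> that are coarser than the quotient topology.
\<close>

definition countable_type :: "bool \<Rightarrow> 'a set set \<Rightarrow> bool" where
  "countable_type b \<gamma> \<longleftrightarrow> (\<exists>\<S>. countable \<S> \<and> (b \<longrightarrow> (\<forall>S\<in>\<S>. openin T S)) \<and>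
     (\<forall>x\<in>carrier G. \<forall>V\<in>\<gamma>. \<exists>S\<in>\<S>. x \<in> S \<and> S \<subseteq> x <# V))"

lemma l_coset_mono: "A \<subseteq> B \<Longrightarrow> x <# A \<subseteq> x <# B"
  unfolding l_coset_def by blast

text \<open>
  The countable type of a product, restricted to a subspace: a topology generated by the
  intersections of members of two families of countable type has countable type.
\<close>

lemma countable_type_join:
  assumes \<gamma>: "countable_type b \<gamma>" and \<gamma>': "countable_type b \<gamma>'"
    and sub: "\<And>V. V \<in> \<gamma> \<Longrightarrow> V \<subseteq> carrier G" "\<And>V. V \<in> \<gamma>' \<Longrightarrow> V \<subseteq> carrier G"
    and ref: "\<And>U. U \<in> \<delta> \<Longrightarrow> \<exists>V\<in>\<gamma>. \<exists>V'\<in>\<gamma>'. V \<inter> V' \<subseteq> U"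
    and sub': "\<And>U. U \<in> \<delta> \<Longrightarrow> U \<subseteq> carrier G"
  shows "countable_type b \<delta>"
proof -
  obtain \<S> where S: "countable \<S>" "b \<longrightarrow> (\<forall>S\<in>\<S>. openin T S)"
    "\<forall>x\<in>carrier G. \<forall>V\<in>\<gamma>. \<exists>S\<in>\<S>. x \<in> S \<and> S \<subseteq> x <# V"
    using \<gamma> unfolding countable_type_def by blast
  obtain \<S>' where S': "countable \<S>'" "b \<longrightarrow> (\<forall>S\<in>\<S>'. openin T S)"
    "\<forall>x\<in>carrier G. \<forall>V\<in>\<gamma>'. \<exists>S\<in>\<S>'. x \<in> S \<and> S \<subseteq> x <# V"
    using \<gamma>' unfolding countable_type_def by blast
  define R where "R = (\<lambda>(S, S'). S \<inter> S') ` (\<S> \<times> \<S>')"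
  have "countable R" unfolding R_def using S(1) S'(1) by (intro countable_image countable_SIGMA)
  moreover have "b \<longrightarrow> (\<forall>S\<in>R. openin T S)" unfolding R_def using S(2) S'(2) by (auto intro!: openin_Int)
  moreover have "\<exists>S\<in>R. x \<in> S \<and> S \<subseteq> x <# U" if x: "x \<in> carrier G" and U: "U \<in> \<delta>" for x U
  proof -
    obtain V V' where V: "V \<in> \<gamma>" "V' \<in> \<gamma>'" "V \<inter> V' \<subseteq> U" using ref[OF U] by blast
    obtain A where A: "A \<in> \<S>" "x \<in> A" "A \<subseteq> x <# V" using S(3) x V(1) by blast
    obtain B where B: "B \<in> \<S>'" "x \<in> B" "B \<subseteq> x <# V'" using S'(3) x V(2) by blast
    have "A \<inter> B \<subseteq> x <# U"
    proof
      fix y assume "y \<in> A \<inter> B"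
      then have "y \<in> x <# V" "y \<in> x <# V'" using A(3) B(3) by auto
      then show "y \<in> x <# U"
        using V(3) by (auto simp: mem_l_coset_iff sub(1)[OF V(1)] sub(2)[OF V(2)] sub'[OF U] x)
    qed
    moreover have "A \<inter> B \<in> R" unfolding R_def using A(1) B(1) by (intro image_eqI[of _ _ "(A, B)"]) auto
    ultimately show ?thesis using A(2) B(2) by (intro bexI[of _ "A \<inter> B"] conjI IntI)
  qed
  ultimately show ?thesis unfolding countable_type_def by blast
qed

lemma countable_type_UN:
  assumes "\<And>n::nat. countable_type b (\<gamma> n)"
    and ref: "\<And>U. U \<in> \<delta> \<Longrightarrow> \<exists>n. \<exists>V\<in>\<gamma> n. V \<subseteq> U"
  shows "countable_type b \<delta>"
proof -
  have "\<exists>\<S>. countable \<S> \<and> (b \<longrightarrow> (\<forall>S\<in>\<S>. openin T S)) \<and>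
     (\<forall>x\<in>carrier G. \<forall>V\<in>\<gamma> n. \<exists>S\<in>\<S>. x \<in> S \<and> S \<subseteq> x <# V)" for n
    using assms(1)[of n] unfolding countable_type_def .
  then obtain \<S> where S: "\<And>n. countable (\<S> n)" "\<And>n. b \<longrightarrow> (\<forall>S\<in>\<S> n. openin T S)"
     "\<And>n. \<forall>x\<in>carrier G. \<forall>V\<in>\<gamma> n. \<exists>S\<in>\<S> n. x \<in> S \<and> S \<subseteq> x <# V"
    by metis
  define R where "R = (\<Union>n. \<S> n)"
  have "countable R" unfolding R_def using S(1) by simp
  moreover have "b \<longrightarrow> (\<forall>S\<in>R. openin T S)" unfolding R_def using S(2) by auto
  moreover have "\<exists>S\<in>R. x \<in> S \<and> S \<subseteq> x <# U" if x: "x \<in> carrier G" and U: "U \<in> \<delta>" for x U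
  proof -
    obtain n V where V: "V \<in> \<gamma> n" "V \<subseteq> U" using ref[OF U] by blast
    obtain A where A: "A \<in> \<S> n" "x \<in> A" "A \<subseteq> x <# V" using S(3) x V(1) by blast
    then have "A \<in> R" "A \<subseteq> x <# U" using l_coset_mono[OF V(2), of x] by (auto simp: R_def)
    then show ?thesis using A(2) by blast
  qed
  ultimately show ?thesis unfolding countable_type_def by blast
qed

lemma quotient_base_subset:
  assumes "V \<in> quotient_base N" "N \<subseteq> carrier G"
  shows "V \<subseteq> carrier G"
proof -
  obtain W where "unit_nhd W" "V = W <#> N" using assms(1) by (auto simp: quotient_base_def)
  then show ?thesis using set_mult_closed[OF unit_nhd_subset assms(2)] by simp
qed

text \<open>
  Normality of \<open>N\<close> moves it to the right: \<open>WN(WN)\<inverse> \<subseteq> WW\<inverse>N\<close>.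
\<close>

lemma set_mult_quotient_closed:
  assumes N: "N \<lhd> G" and W: "W \<subseteq> carrier G" and xy: "x \<in> W <#> N" "y \<in> W <#> N"
    and U: "\<And>w w'. w \<in> W \<Longrightarrow> w' \<in> W \<Longrightarrow> w \<otimes> inv w' \<in> U"
  shows "x \<otimes> inv y \<in> U <#> N"
proof -
  interpret N: normal N G by (rule N)
  obtain w n where wn: "w \<in> W" "n \<in> N" "x = w \<otimes> n" using xy(1) by (rule set_mult_memE)
  obtain w' n' where wn': "w' \<in> W" "n' \<in> N" "y = w' \<otimes> n'" using xy(2) by (rule set_mult_memE)
  have c: "w \<in> carrier G" "w' \<in> carrier G" "n \<in> carrier G" "n' \<in> carrier G"
    using wn wn' W N.subset by auto
  have "w' \<otimes> (n \<otimes> inv n') \<otimes> inv w' \<in> N"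
    using N.inv_op_closed2[OF c(2), of "n \<otimes> inv n'"] wn(2) wn'(2) by simp
  moreover have "x \<otimes> inv y = (w \<otimes> inv w') \<otimes> (w' \<otimes> (n \<otimes> inv n') \<otimes> inv w')"
    using c wn(3) wn'(3) by (simp add: group_simps)
  ultimately show ?thesis using set_mult_memI[OF U[OF wn(1) wn'(1)]] by simp
qed

text \<open>
  For a decreasing sequence of normal subgroups this is the group topology that \<open>G\<close> inherits from the
  product of the quotients \<open>G/N n\<close>. A constant sequence gives a single quotient.
\<close>

lemma quotient_bases_filter_base:
  assumes N: "\<And>n::nat. N n \<lhd> G" and dec: "decseq N"
  shows "group_filter_base (\<Union>n. quotient_base (N n))"
proof -
  have sg: "subgroup (N n) G" for n using N normal_imp_subgroup by blast
  show ?thesis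
    unfolding group_filter_base_def
  proof (intro conjI ballI)
    show "(\<Union>n. quotient_base (N n)) \<noteq> {}"
      using unit_nhd_carrier by (auto simp: quotient_base_def)
    show "unit_nhd V" if "V \<in> (\<Union>n. quotient_base (N n))" for V
      using that unit_nhd_set_mult[OF _ sg] by (auto simp: quotient_base_def)
    show "\<exists>U\<in>(\<Union>n. quotient_base (N n)). U \<subseteq> V \<inter> W"
      if VW: "V \<in> (\<Union>n. quotient_base (N n))" "W \<in> (\<Union>n. quotient_base (N n))" for V W
    proof -
      obtain n m A B where *: "unit_nhd A" "V = A <#> N n" "unit_nhd B" "W = B <#> N m"
        using VW by (auto simp: quotient_base_def)
      have "N (max n m) \<subseteq> N n" "N (max n m) \<subseteq> N m" using dec by (auto simp: decseq_def)
      then have "(A \<inter> B) <#> N (max n m) \<subseteq> V \<inter> W"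
        unfolding * by (metis Int_greatest Int_lower1 Int_lower2 mono_set_mult)
      moreover have "(A \<inter> B) <#> N (max n m) \<in> (\<Union>n. quotient_base (N n))"
        using *(1,3) unit_nhd_Int by (auto simp: quotient_base_def)
      ultimately show ?thesis by blast
    qed
    show "\<exists>W\<in>(\<Union>n. quotient_base (N n)). \<forall>x\<in>W. \<forall>y\<in>W. x \<otimes> inv y \<in> V"
      if V: "V \<in> (\<Union>n. quotient_base (N n))" for V
    proof -
      obtain n U where U: "unit_nhd U" "V = U <#> N n" using V by (auto simp: quotient_base_def)
      obtain W where W: "unit_nhd W" "W \<subseteq> U" "\<And>x. x \<in> W \<Longrightarrow> inv x \<in> W"
         "\<And>x y. x \<in> W \<Longrightarrow> y \<in> W \<Longrightarrow> x \<otimes> y \<in> U"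
        using unit_nhd_symmetric_root[OF U(1)] by blast
      have "\<forall>x\<in>W <#> N n. \<forall>y\<in>W <#> N n. x \<otimes> inv y \<in> V"
        using set_mult_quotient_closed[OF N unit_nhd_subset[OF W(1)]] W(3,4) U(2) by blast
      moreover have "W <#> N n \<in> (\<Union>n. quotient_base (N n))" using W(1) by (auto simp: quotient_base_def)
      ultimately show ?thesis by blast
    qed
  qed
qed

lemma Inter_quotient_bases:
  assumes N: "\<And>n::nat. N n \<lhd> G" "\<And>n. closedin T (N n)"
  shows "\<Inter>(\<Union>n. quotient_base (N n)) = (\<Inter>n. N n)"
proof
  have sg: "subgroup (N n) G" for n using N normal_imp_subgroup by blast
  show "\<Inter>(\<Union>n. quotient_base (N n)) \<subseteq> (\<Inter>n. N n)"
  proof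
    fix x assume x: "x \<in> \<Inter>(\<Union>n. quotient_base (N n))"
    have "x \<in> W <#> N n" if "unit_nhd W" for W n
      using x that by (auto simp: quotient_base_def)
    moreover from this have "x \<in> carrier G"
      using unit_nhd_carrier set_mult_closed[OF order_refl subgroup.subset[OF sg]] by blast
    ultimately show "x \<in> (\<Inter>n. N n)" using closed_subgroup_memI N(2) by blast
  qed
  show "(\<Inter>n. N n) \<subseteq> \<Inter>(\<Union>n. quotient_base (N n))"
    using subset_set_mult_right[OF _ subgroup.subset[OF sg]]
    by (fastforce simp: quotient_base_def unit_nhd_def)
qed

text \<open>
  The embedding of \<open>G/N\<close> into the product of \<open>G/B\<close> and the quotient of \<open>G\<close> given by \<open>\<gamma>\<close>, where
  \<open>N = B \<inter> \<Inter>\<gamma>\<close>: neighbourhoods of the identity from the two factors cut out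
  arbitrarily small neighbourhoods of \<open>N\<close>. The set \<open>B/N\<close> is compact, being covered by the image
  of \<open>B \<inter> K\<close>.
\<close>

lemma compact_extension_separation:
  assumes \<gamma>: "group_filter_base \<gamma>" and K: "compactin T K"
    and B: "subgroup B G" "closedin T B" and N: "subgroup N G" "N \<subseteq> B" "N \<subseteq> \<Inter>\<gamma>" "B \<inter> \<Inter>\<gamma> \<subseteq> N"
    and BK: "B \<subseteq> K <#> N" and U: "unit_nhd U"
  obtains W V where "unit_nhd W" "V \<in> \<gamma>" "(W <#> B) \<inter> V \<subseteq> U <#> N"
proof -
  have Nc: "N \<subseteq> carrier G" using N(1) subgroup.subset by blast
  have Kc: "K \<subseteq> carrier G" using compactin_subset_topspace[OF K] topspace_eq by simp
  have Uc: "U \<subseteq> carrier G" using U unit_nhd_subset by blast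
  have C: "compactin T (B \<inter> K)" using closed_Int_compactin[OF B(2) K] .
  have "openin T (U <#> N)" using U unit_nhd_set_mult[OF _ N(1)] by (auto simp: unit_nhd_def)
  moreover have "U <#> N <#> N \<subseteq> U <#> N"
    using set_mult_assoc[OF Uc Nc Nc] subgroup_mult_id[OF N(1)] by simp
  moreover have "B \<inter> K \<inter> \<Inter>\<gamma> \<subseteq> U <#> N"
    using N(4) subset_set_mult_right[of U N] U Nc by (auto simp: unit_nhd_def)
  ultimately obtain W V where WV: "unit_nhd W" "V \<in> \<gamma>" "(W <#> (B \<inter> K) <#> N) \<inter> V \<subseteq> U <#> N"
    using compact_separation[OF \<gamma> C N(1,3)] by metis
  have "B \<subseteq> (B \<inter> K) <#> N"
  proof
    fix x assume x: "x \<in> B"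
    then obtain k n where kn: "k \<in> K" "n \<in> N" "x = k \<otimes> n"
      using BK by (meson set_mult_memE subsetD)
    have "k = x \<otimes> inv n" using kn Kc Nc by (auto simp: group_simps subset_iff)
    moreover have "inv n \<in> B" using kn(2) N(2) B(1) subgroup.m_inv_closed by (metis subsetD)
    ultimately have "k \<in> B" using x B(1) subgroup.m_closed by metis
    then show "x \<in> (B \<inter> K) <#> N" using kn set_mult_memI by auto
  qed
  then have "W <#> B \<subseteq> W <#> (B \<inter> K) <#> N"
    using set_mult_assoc[of W "B \<inter> K" N] unit_nhd_subset[OF WV(1)] Kc Nc set_mult_right_mono
    by (metis le_infI2)
  then show thesis using that WV by blast
qed

lemma countable_type_compact_extension:
  assumes \<gamma>: "group_filter_base \<gamma>" "countable_type b \<gamma>" and K: "compactin T K"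
    and B: "subgroup B G" "closedin T B" "countable_type b (quotient_base B)"
    and N: "subgroup N G" "N \<subseteq> B" "N \<subseteq> \<Inter>\<gamma>" "B \<inter> \<Inter>\<gamma> \<subseteq> N"
    and BK: "B \<subseteq> K <#> N"
  shows "countable_type b (quotient_base N)"
proof (rule countable_type_join[OF B(3) \<gamma>(2)])
  show "V \<subseteq> carrier G" if "V \<in> quotient_base B" for V
    using quotient_base_subset[OF that subgroup.subset[OF B(1)]] .
  show "V \<subseteq> carrier G" if "V \<in> \<gamma>" for V
    using \<gamma>(1) that unit_nhd_subset by (auto simp: group_filter_base_def)
  show "V \<subseteq> carrier G" if "V \<in> quotient_base N" for V
    using quotient_base_subset[OF that subgroup.subset[OF N(1)]] .
  show "\<exists>V\<in>quotient_base B. \<exists>V'\<in>\<gamma>. V \<inter> V' \<subseteq> U" if U: "U \<in> quotient_base N" for U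
  proof -
    obtain U' where U': "unit_nhd U'" "U = U' <#> N" using U by (auto simp: quotient_base_def)
    obtain W V where "unit_nhd W" "V \<in> \<gamma>" "(W <#> B) \<inter> V \<subseteq> U' <#> N"
      using compact_extension_separation[OF \<gamma>(1) K B(1,2) N BK U'(1)] by blast
    then show ?thesis using U'(2) by (auto simp: quotient_base_def)
  qed
qed

section \<open>Sets containing a countable intersection of neighbourhoods\<close>

text \<open>
  This smallness condition on \<open>A\<close> allows countably many members of a lattice to be pushed below \<open>AK\<close>.
\<close>

definition contains_unit_G_delta :: "'a set \<Rightarrow> bool" where
  "contains_unit_G_delta A \<longleftrightarrow> (\<exists>Q::nat \<Rightarrow> 'a set. (\<forall>n. unit_nhd (Q n)) \<and> (\<Inter>n. Q n) \<subseteq> A)"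

lemma contains_unit_G_delta_countable:
  assumes "countable \<Q>" "\<And>Q. Q \<in> \<Q> \<Longrightarrow> unit_nhd Q" "carrier G \<inter> \<Inter>\<Q> \<subseteq> A"
  shows "contains_unit_G_delta A"
proof -
  let ?Q = "from_nat_into (insert (carrier G) \<Q>)"
  have r: "range ?Q = insert (carrier G) \<Q>" using assms(1) by (intro range_from_nat_into) auto
  then have "unit_nhd (?Q n)" for n
    using assms(2) unit_nhd_carrier by (metis insert_iff rangeI)
  moreover have "\<Inter>(range ?Q) \<subseteq> A" unfolding r using assms(3) by simp
  ultimately show ?thesis unfolding contains_unit_G_delta_def by blast
qed

lemma contains_unit_G_delta_Int:
  assumes "contains_unit_G_delta A" "contains_unit_G_delta B"
  shows "contains_unit_G_delta (A \<inter> B)"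
proof -
  obtain P Q :: "nat \<Rightarrow> 'a set" where PQ: "\<forall>n. unit_nhd (P n)" "(\<Inter>n. P n) \<subseteq> A"
    "\<forall>n. unit_nhd (Q n)" "(\<Inter>n. Q n) \<subseteq> B"
    using assms unfolding contains_unit_G_delta_def by blast
  have "\<forall>n. unit_nhd (P n \<inter> Q n)" using PQ(1,3) unit_nhd_Int by blast
  moreover have "(\<Inter>n. P n \<inter> Q n) \<subseteq> A \<inter> B" using PQ(2,4) by blast
  ultimately show ?thesis
    unfolding contains_unit_G_delta_def by (intro exI[of _ "\<lambda>n. P n \<inter> Q n"]) blast
qed

text \<open>
  By regularity every \<open>x\<close> outside \<open>N\<close> lies in a member of the network whose closure misses the
  identity, so the complements of the closures of such members have intersection inside \<open>N\<close>.
\<close>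

lemma contains_unit_G_delta_of_countable_type:
  assumes N: "N \<lhd> G" "closedin T N" and ct: "countable_type b (quotient_base N)"
  shows "contains_unit_G_delta N"
proof -
  interpret N: normal N G by (rule N)
  obtain \<S> where S: "countable \<S>"
    "\<forall>x\<in>carrier G. \<forall>V\<in>quotient_base N. \<exists>S\<in>\<S>. x \<in> S \<and> S \<subseteq> x <# V"
    using ct unfolding countable_type_def by blast
  \<comment> \<open>Members with the identity in their closure are discarded, as their complements are no
    neighbourhoods of it.\<close>
  define \<Q> where "\<Q> = {carrier G - T closure_of S | S. S \<in> \<S> \<and> \<one> \<notin> T closure_of S}"
  show ?thesis
  proof (rule contains_unit_G_delta_countable)
    have "\<Q> \<subseteq> (\<lambda>S. carrier G - T closure_of S) ` \<S>" by (auto simp: \<Q>_def)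
    then show "countable \<Q>" using countable_image[OF S(1)] by (rule countable_subset)
    show "unit_nhd Q" if "Q \<in> \<Q>" for Q
      using that closedin_closure_of[of T] topspace_eq by (auto simp: \<Q>_def unit_nhd_def closedin_def)
    show "carrier G \<inter> \<Inter>\<Q> \<subseteq> N"
    proof (rule ccontr)
      assume "\<not> carrier G \<inter> \<Inter>\<Q> \<subseteq> N"
      then obtain x where x: "x \<in> carrier G" "x \<in> \<Inter>\<Q>" "x \<notin> N" by blast
      have "\<not> (\<forall>W. unit_nhd W \<longrightarrow> inv x \<in> W <#> N)"
        using closed_subgroup_memI[OF N(2), of "inv x"] x N.m_inv_closed[of "inv x"] by auto
      then obtain U where U: "unit_nhd U" "inv x \<notin> U <#> N" by blast
      obtain W where W: "unit_nhd W" "W \<subseteq> U" "\<And>x. x \<in> W \<Longrightarrow> inv x \<in> W"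
         "\<And>x y. x \<in> W \<Longrightarrow> y \<in> W \<Longrightarrow> x \<otimes> y \<in> U"
        using unit_nhd_symmetric_root[OF U(1)] by blast
      have Wc: "W \<subseteq> carrier G" using W(1) unit_nhd_subset by blast
      have "W <#> N \<in> quotient_base N" using W(1) by (auto simp: quotient_base_def)
      then obtain S where S': "S \<in> \<S>" "x \<in> S" "S \<subseteq> x <# (W <#> N)"
        using S(2) x(1) by blast
      have Sc: "S \<subseteq> carrier G"
        using S'(3) l_coset_subset_G[OF set_mult_closed[OF Wc N.subset] x(1)] by blast
      have "\<one> \<notin> T closure_of S"
      proof
        assume "\<one> \<in> T closure_of S"
        then obtain y where y: "y \<in> S" "y \<in> W"
          using W(1) unfolding in_closure_of unit_nhd_def by blast
        have yc: "y \<in> carrier G" using y(1) Sc by blast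
        have "inv x \<otimes> y \<in> W <#> N"
          using y(1) S'(3) mem_l_coset_iff[OF set_mult_closed[OF Wc N.subset] x(1)] by blast
        moreover have "y \<in> W <#> N"
          using y(2) subset_set_mult_left[OF N.one_closed Wc] by blast
        ultimately have "(inv x \<otimes> y) \<otimes> inv y \<in> U <#> N"
          using set_mult_quotient_closed[OF N(1) Wc] W(3,4) by blast
        moreover have "(inv x \<otimes> y) \<otimes> inv y = inv x"
          using x(1) yc by (simp add: m_assoc)
        ultimately show False using U(2) by simp
      qed
      then have "carrier G - T closure_of S \<in> \<Q>" using S'(1) by (auto simp: \<Q>_def)
      moreover have "x \<in> T closure_of S"
        using S'(2) Sc closure_of_subset[of S T] topspace_eq by auto
      ultimately show False using x(2) by blast
    qed
  qed
qed

text \<open>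
  Regularity replaces the open sets by a decreasing sequence of closed neighbourhoods, to which
  \<open>compact_set_mult_Inter\<close> applies.
\<close>

lemma contains_unit_G_delta_closed:
  assumes "contains_unit_G_delta A"
  obtains D :: "nat \<Rightarrow> 'a set" and W where "\<And>n. closedin T (D n)" "decseq D" "(\<Inter>n. D n) \<subseteq> A"
    "\<And>n. unit_nhd (W n)" "\<And>n. W n \<subseteq> D n"
proof -
  obtain Q :: "nat \<Rightarrow> 'a set" where Q: "\<And>n. unit_nhd (Q n)" "(\<Inter>n. Q n) \<subseteq> A"
    using assms unfolding contains_unit_G_delta_def by blast
  have "\<exists>W. unit_nhd W \<and> T closure_of W \<subseteq> Q n" for n
  proof -
    obtain W where W: "unit_nhd W" "W \<subseteq> Q n" "\<And>x. x \<in> W \<Longrightarrow> inv x \<in> W"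
       "\<And>x y. x \<in> W \<Longrightarrow> y \<in> W \<Longrightarrow> x \<otimes> y \<in> Q n"
      using unit_nhd_symmetric_root[OF Q(1)[of n]] by blast
    have "T closure_of W \<subseteq> Q n" by (rule closure_of_root_subset[OF W(1)]) (use W(3,4) in blast)
    then show ?thesis using W(1) by blast
  qed
  then obtain W where W: "\<And>n. unit_nhd (W n)" "\<And>n. T closure_of W n \<subseteq> Q n" by metis
  show thesis
  proof
    show "closedin T (\<Inter>i\<le>n. T closure_of W i)" for n
      by (intro closedin_INT) auto
    show "decseq (\<lambda>n. \<Inter>i\<le>n. T closure_of W i)" unfolding decseq_def
      by (intro allI impI INT_anti_mono) auto
    have "(\<Inter>n. \<Inter>i\<le>n. T closure_of W i) \<subseteq> (\<Inter>n. Q n)"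
      using W(2) by (intro INT_greatest) (meson INT_lower UNIV_I atMost_iff order.refl order.trans)
    then show "(\<Inter>n. \<Inter>i\<le>n. T closure_of W i) \<subseteq> A" using Q(2) by (rule order.trans)
    have "openin T (\<Inter>i\<le>n. W i)" for n
      using W(1) by (intro openin_INT2) (auto simp: unit_nhd_def)
    then show "unit_nhd (\<Inter>i\<le>n. W i)" for n
      using W(1) by (simp add: unit_nhd_def)
    show "(\<Inter>i\<le>n. W i) \<subseteq> (\<Inter>i\<le>n. T closure_of W i)" for n
      using closure_of_subset[of "W _" T] unit_nhd_subset[OF W(1)] topspace_eq
      by (intro INF_superset_mono[OF order_refl]) auto
  qed
qed

section \<open>Lattices of subgroups\<close>

text \<open>
  The family of kernels, pulled back to \<open>G\<close>, of a strong \<open>\<sigma>\<close>-lattice of open homomorphisms of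
  \<open>G/K\<close>. After the description of the members the clauses are: generation of the topology of \<open>G/K\<close>,
  lower bounds, and for decreasing sequences membership of the limit, its topology and completeness.
  For \<open>K = {\<one>}\<close> the lattice is one of \<open>G\<close> itself. Nonemptiness, which a strong \<open>\<sigma>\<close>-lattice has as
  the lower bound of the empty family, follows from the generation clause.
\<close>

definition subgroup_lattice :: "'a set \<Rightarrow> bool \<Rightarrow> 'a set set \<Rightarrow> bool" where
  "subgroup_lattice K b \<H> \<longleftrightarrow>
     (\<forall>H\<in>\<H>. H \<lhd> G \<and> closedin T H \<and> K \<subseteq> H \<and> countable_type b (quotient_base H)) \<and>
     (\<forall>U. unit_nhd U \<longrightarrow> (\<exists>H\<in>\<H>. \<exists>V. unit_nhd V \<and> V <#> H \<subseteq> U <#> K)) \<and>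
     (\<forall>H\<in>\<H>. \<forall>H'\<in>\<H>. \<exists>L\<in>\<H>. L \<subseteq> H \<inter> H') \<and>
     (\<forall>H. range H \<subseteq> \<H> \<and> decseq H \<longrightarrow>
        (\<Inter>n. H n) \<in> \<H> \<and>
        (\<forall>U. unit_nhd U \<longrightarrow> (\<exists>n V. unit_nhd V \<and> V <#> H n \<subseteq> U <#> (\<Inter>n. H n))) \<and>
        (\<forall>x. (\<forall>n. x n \<in> carrier G) \<and> (\<forall>k n. k < n \<longrightarrow> x n \<in> x k <# H k) \<longrightarrow>
           (\<exists>z\<in>carrier G. \<forall>n. z \<in> x n <# H n)))"

lemma subgroup_lattice_member:
  assumes "subgroup_lattice K b \<H>" "H \<in> \<H>"
  shows "H \<lhd> G" "closedin T H" "K \<subseteq> H" "countable_type b (quotient_base H)"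
  using assms unfolding subgroup_lattice_def by blast+

lemma subgroup_lattice_nhd:
  assumes "subgroup_lattice K b \<H>" "unit_nhd U"
  obtains H V where "H \<in> \<H>" "unit_nhd V" "V <#> H \<subseteq> U <#> K"
  using assms unfolding subgroup_lattice_def by meson

lemma subgroup_lattice_Int:
  assumes "subgroup_lattice K b \<H>" "H \<in> \<H>" "H' \<in> \<H>"
  obtains L where "L \<in> \<H>" "L \<subseteq> H" "L \<subseteq> H'"
  using assms unfolding subgroup_lattice_def by (meson le_infE)

lemma subgroup_lattice_decseq:
  assumes "subgroup_lattice K b \<H>" "\<And>n::nat. H n \<in> \<H>" "decseq H"
  shows "(\<Inter>n. H n) \<in> \<H>"
    and "unit_nhd U \<Longrightarrow> \<exists>n V. unit_nhd V \<and> V <#> H n \<subseteq> U <#> (\<Inter>n. H n)"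
    and "(\<And>n. x n \<in> carrier G) \<Longrightarrow> (\<And>k n. k < n \<Longrightarrow> x n \<in> x k <# H k) \<Longrightarrow>
      \<exists>z\<in>carrier G. \<forall>n. z \<in> x n <# H n"
proof -
  have r: "range H \<subseteq> \<H>" using assms(2) by blast
  have *: "(\<Inter>n. H n) \<in> \<H> \<and>
        (\<forall>U. unit_nhd U \<longrightarrow> (\<exists>n V. unit_nhd V \<and> V <#> H n \<subseteq> U <#> (\<Inter>n. H n))) \<and>
        (\<forall>x. (\<forall>n. x n \<in> carrier G) \<and> (\<forall>k n. k < n \<longrightarrow> x n \<in> x k <# H k) \<longrightarrow>
           (\<exists>z\<in>carrier G. \<forall>n. z \<in> x n <# H n))"
    using assms(1) r assms(3) unfolding subgroup_lattice_def by meson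
  show "(\<Inter>n. H n) \<in> \<H>" using * by (rule conjunct1)
  show "unit_nhd U \<Longrightarrow> \<exists>n V. unit_nhd V \<and> V <#> H n \<subseteq> U <#> (\<Inter>n. H n)" using * by blast
  show "(\<And>n. x n \<in> carrier G) \<Longrightarrow> (\<And>k n. k < n \<Longrightarrow> x n \<in> x k <# H k) \<Longrightarrow>
      \<exists>z\<in>carrier G. \<forall>n. z \<in> x n <# H n" using * by blast
qed

text \<open>
  Choose decreasing members below the first \<open>n\<close> subgroups and intersect them.
\<close>

lemma subgroup_lattice_countable_lower_bound:
  assumes L: "subgroup_lattice K b \<H>" and H: "\<And>n::nat. H n \<in> \<H>"
  obtains H' where "H' \<in> \<H>" "H' \<subseteq> (\<Inter>n. H n)"
proof -
  have "\<exists>P. \<forall>n. (P n \<in> \<H> \<and> P n \<subseteq> H n) \<and> P (Suc n) \<subseteq> P n"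
  proof (rule dependent_nat_choice)
    show "\<exists>x. x \<in> \<H> \<and> x \<subseteq> H 0" using H by blast
    show "\<exists>y. (y \<in> \<H> \<and> y \<subseteq> H (Suc n)) \<and> y \<subseteq> x" if "x \<in> \<H> \<and> x \<subseteq> H n" for x n
      using subgroup_lattice_Int[OF L, of x "H (Suc n)"] that H by metis
  qed
  then obtain P where P: "\<And>n. P n \<in> \<H>" "\<And>n. P n \<subseteq> H n" "\<And>n. P (Suc n) \<subseteq> P n" by blast
  have "decseq P" using P(3) by (simp add: decseq_Suc_iff)
  then have "(\<Inter>n. P n) \<in> \<H>" using subgroup_lattice_decseq(1)[OF L, of P] P(1) by blast
  then show thesis using that P(2) by blast
qed

text \<open>
  If \<open>D n\<close> are decreasing closed neighbourhoods of the identity with intersection in \<open>A\<close>, each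
  \<open>(D n) K\<close> contains a member of the lattice. A lower bound of these members lies in
  \<open>\<Inter> (D n) K = (\<Inter> D n) K\<close>.
\<close>

lemma subgroup_lattice_below_G_delta:
  assumes L: "subgroup_lattice K b \<H>" and K: "compactin T K" and A: "contains_unit_G_delta A"
  obtains H where "H \<in> \<H>" "H \<subseteq> A <#> K"
proof -
  obtain D :: "nat \<Rightarrow> 'a set" and W where D: "\<And>n. closedin T (D n)" "decseq D" "(\<Inter>n. D n) \<subseteq> A"
    and W: "\<And>n. unit_nhd (W n)" "\<And>n. W n \<subseteq> D n"
    using contains_unit_G_delta_closed[OF A] by blast
  have "\<exists>H. H \<in> \<H> \<and> H \<subseteq> D n <#> K" for n
  proof -
    obtain H V where HV: "H \<in> \<H>" "unit_nhd V" "V <#> H \<subseteq> W n <#> K"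
      using subgroup_lattice_nhd[OF L W(1)] by blast
    have "subgroup H G" using subgroup_lattice_member(1)[OF L HV(1)] normal_imp_subgroup by blast
    then have "H \<subseteq> V <#> H"
      using HV(2) subset_set_mult_right subgroup.subset by (metis unit_nhd_def)
    also have "\<dots> \<subseteq> D n <#> K" using HV(3) set_mult_left_mono[OF W(2)] by blast
    finally show ?thesis using HV(1) by blast
  qed
  then obtain H where H: "\<And>n. H n \<in> \<H>" "\<And>n. H n \<subseteq> D n <#> K" by metis
  obtain H' where H': "H' \<in> \<H>" "H' \<subseteq> (\<Inter>n. H n)"
    by (rule subgroup_lattice_countable_lower_bound[OF L H(1)])
  have "H' \<subseteq> (\<Inter>n. D n) <#> K"
  proof
    fix x assume "x \<in> H'"
    then have "x \<in> D n <#> K" for n using H'(2) H(2)[of n] by blast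
    then show "x \<in> (\<Inter>n. D n) <#> K" by (rule compact_set_mult_Inter[OF K D(1,2)])
  qed
  also have "\<dots> \<subseteq> A <#> K" using D(3) by (rule set_mult_left_mono)
  finally show thesis using that H'(1) by blast
qed

text \<open>
  The modular law \<open>(A \<inter> H) K = AK \<inter> H\<close> for \<open>K \<subseteq> H\<close>.
\<close>

lemma Int_set_mult_eq:
  assumes A: "subgroup A G" and H: "subgroup H G" and K: "K \<subseteq> H" "H \<subseteq> A <#> K"
  shows "(A \<inter> H) <#> K = H"
proof
  show "(A \<inter> H) <#> K \<subseteq> H"
    using subgroup.m_closed[OF H] K(1) by (auto simp: set_mult_def)
  show "H \<subseteq> (A \<inter> H) <#> K"
  proof
    fix h assume h: "h \<in> H"
    then obtain a k where ak: "a \<in> A" "k \<in> K" "h = a \<otimes> k" using K(2) by (meson set_mult_memE subsetD)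
    then have "a = h \<otimes> inv k"
      using subgroup.subset[OF A] subgroup.subset[OF H] K(1) by (simp add: m_assoc subset_iff)
    moreover have "inv k \<in> H" using ak(2) K(1) subgroup.m_inv_closed[OF H] by blast
    ultimately have "a \<in> H" using h subgroup.m_closed[OF H] by simp
    then show "h \<in> (A \<inter> H) <#> K" using ak set_mult_memI by simp
  qed
qed

lemma normal_Int: "A \<lhd> G \<Longrightarrow> B \<lhd> G \<Longrightarrow> A \<inter> B \<lhd> G"
  unfolding normal_inv_iff using subgroups_Inter_pair by blast

section \<open>Narrow groups\<close>

text \<open>
  A group with a countable network is Lindeloef, so countably many translates \<open>d V H\<close> cover \<open>G\<close>
  whenever \<open>H\<close> is in the lattice. For suitable \<open>H\<close> and \<open>V\<close> these are contained in \<open>d K W\<close>, and \<open>K\<close>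
  is covered by finitely many translates of \<open>W\<close>.
\<close>

lemma subgroup_lattice_countable_translates:
  assumes L: "subgroup_lattice K b \<H>" and K: "K \<lhd> G" "compactin T K" and U: "unit_nhd U"
  shows "\<exists>D. countable D \<and> D \<subseteq> carrier G \<and> (\<forall>x\<in>carrier G. \<exists>d\<in>D. x \<in> d <# U)"
proof -
  interpret K: normal K G by (rule K)
  have Uc: "U \<subseteq> carrier G" using U unit_nhd_subset by blast
  obtain W where W: "unit_nhd W" "W \<subseteq> U" "\<And>x. x \<in> W \<Longrightarrow> inv x \<in> W"
     "\<And>x y. x \<in> W \<Longrightarrow> y \<in> W \<Longrightarrow> x \<otimes> y \<in> U"
    using unit_nhd_symmetric_root[OF U] by blast
  have Wc: "W \<subseteq> carrier G" using W(1) unit_nhd_subset by blast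
  have "\<exists>\<F>. finite \<F> \<and> \<F> \<subseteq> (\<lambda>k. k <# W) ` K \<and> K \<subseteq> \<Union>\<F>"
  proof -
    have "\<forall>Q\<in>(\<lambda>k. k <# W) ` K. openin T Q"
      using W(1) open_l_coset K.subset by (auto simp: unit_nhd_def)
    moreover have "k \<in> k <# W" if "k \<in> K" for k
      using that W(1) mem_l_coset_iff[OF Wc K.mem_carrier[OF that]] K.mem_carrier by (simp add: unit_nhd_def)
    then have "K \<subseteq> \<Union>((\<lambda>k. k <# W) ` K)" by blast
    ultimately show ?thesis using K(2) unfolding compactin_def by meson
  qed
  then obtain \<F> where \<F>: "finite \<F>" "\<F> \<subseteq> (\<lambda>k. k <# W) ` K" "K \<subseteq> \<Union>\<F>" by blast
  obtain E where E: "E \<subseteq> K" "finite E" "\<F> = (\<lambda>k. k <# W) ` E"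
    using finite_subset_image[OF \<F>(1,2)] by blast
  obtain H V where HV: "H \<in> \<H>" "unit_nhd V" "V <#> H \<subseteq> W <#> K"
    using subgroup_lattice_nhd[OF L W(1)] by blast
  have H: "H \<lhd> G" "countable_type b (quotient_base H)" using subgroup_lattice_member[OF L HV(1)] by auto
  interpret H: normal H G by (rule H)
  obtain V' where V': "unit_nhd V'" "V' \<subseteq> V" "\<And>x. x \<in> V' \<Longrightarrow> inv x \<in> V'"
     "\<And>x y. x \<in> V' \<Longrightarrow> y \<in> V' \<Longrightarrow> x \<otimes> y \<in> V"
    using unit_nhd_symmetric_root[OF HV(2)] by blast
  have V'c: "V' \<subseteq> carrier G" using V'(1) unit_nhd_subset by blast
  have VHc: "V' <#> H \<subseteq> carrier G" using set_mult_closed[OF V'c H.subset] .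
  obtain \<S> where S: "countable \<S>"
    "\<forall>x\<in>carrier G. \<forall>V\<in>quotient_base H. \<exists>S\<in>\<S>. x \<in> S \<and> S \<subseteq> x <# V"
    using H(2) unfolding countable_type_def by blast
  define c where "c S = (SOME y. y \<in> S \<inter> carrier G)" for S
  \<comment> \<open>One point \<open>c S\<close> from each set of the countable family, shifted by the finitely many
    \<open>e\<close> whose translates \<open>eW\<close> cover \<open>K\<close>.\<close>
  define D where "D = (\<lambda>(S, e). c S \<otimes> e) ` ({S \<in> \<S>. S \<inter> carrier G \<noteq> {}} \<times> E)"
  have c: "c S \<in> S \<inter> carrier G" if "S \<inter> carrier G \<noteq> {}" for S
    unfolding c_def by (rule someI_ex) (use that in blast)
  show ?thesis
  proof (intro exI[of _ D] conjI ballI)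
    show "countable D" unfolding D_def
      by (intro countable_image countable_SIGMA countable_Collect S(1) countable_finite[OF E(2)])
    show "D \<subseteq> carrier G"
    proof
      fix d assume "d \<in> D"
      then obtain p where p: "p \<in> {S \<in> \<S>. S \<inter> carrier G \<noteq> {}} \<times> E" "d = c (fst p) \<otimes> snd p"
        unfolding D_def case_prod_beta by (rule imageE)
      then have "fst p \<inter> carrier G \<noteq> {}" "snd p \<in> E" by auto
      then have "c (fst p) \<in> carrier G" "snd p \<in> carrier G"
        using c[of "fst p"] E(1) K.subset by blast+
      then show "d \<in> carrier G" using p(2) by simp
    qed
    fix x assume x: "x \<in> carrier G"
    have "V' <#> H \<in> quotient_base H" using V'(1) by (auto simp: quotient_base_def)
    then obtain S where S': "S \<in> \<S>" "x \<in> S" "S \<subseteq> x <# (V' <#> H)" using S(2) x by meson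
    then have Sn: "S \<inter> carrier G \<noteq> {}" using x by blast
    have cc: "c S \<in> carrier G" "c S \<in> S" using c[OF Sn] by auto
    have 1: "inv x \<otimes> c S \<in> V' <#> H"
      using cc S'(3) mem_l_coset_iff[OF VHc x] by blast
    have 2: "\<one> \<in> V' <#> H" using unit_nhd_set_mult[OF V'(1) H.subgroup_axioms] by (simp add: unit_nhd_def)
    have "\<one> \<otimes> inv (inv x \<otimes> c S) \<in> V <#> H"
      using set_mult_quotient_closed[OF H(1) V'c 2 1] V'(3,4) by blast
    then have "inv (c S) \<otimes> x \<in> W <#> K" using HV(3) x cc by (auto simp: inv_mult_group)
    then obtain w k where wk: "w \<in> W" "k \<in> K" "inv (c S) \<otimes> x = w \<otimes> k" by (rule set_mult_memE)
    have wc: "w \<in> carrier G" using wk(1) Wc by blast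
    \<comment> \<open>Normality of \<open>K\<close> turns \<open>w k\<close> into \<open>k' w\<close> with \<open>k' \<in> K\<close>, and \<open>k'\<close> lies in some \<open>eW\<close>.\<close>
    have "w \<otimes> k \<otimes> inv w \<in> K" using K.inv_op_closed2 wc wk(2) by blast
    then obtain e where e: "e \<in> E" "w \<otimes> k \<otimes> inv w \<in> e <# W" using \<F>(3) E(3) by blast
    have ec: "e \<in> carrier G" using e(1) E(1) K.subset by blast
    have "inv e \<otimes> (w \<otimes> k \<otimes> inv w) \<in> W" using e(2) mem_l_coset_iff[OF Wc ec] by blast
    then have "inv e \<otimes> (w \<otimes> k \<otimes> inv w) \<otimes> w \<in> U" using W(4) wk(1) by blast
    moreover have "inv e \<otimes> (w \<otimes> k \<otimes> inv w) \<otimes> w = inv e \<otimes> (w \<otimes> k)"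
      using ec wc wk(2) K.subset by (simp add: m_assoc subset_iff)
    moreover have "inv e \<otimes> (w \<otimes> k) = inv (c S \<otimes> e) \<otimes> x"
      unfolding wk(3)[symmetric] using ec cc x by (simp add: group_simps)
    ultimately have "inv (c S \<otimes> e) \<otimes> x \<in> U" by simp
    then have "x \<in> (c S \<otimes> e) <# U" using mem_l_coset_iff[OF Uc] ec cc x by simp
    moreover have "c S \<otimes> e \<in> D"
      unfolding D_def using S'(1) Sn e(1) by (intro image_eqI[of _ _ "(S, e)"]) auto
    ultimately show "\<exists>d\<in>D. x \<in> d <# U" by blast
  qed
qed

text \<open>
  The usual name of this property is \<open>\<omega>\<close>-narrowness.
\<close>

definition narrow :: bool where
  "narrow \<longleftrightarrow> (\<forall>U. unit_nhd U \<longrightarrow>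
     (\<exists>D. countable D \<and> D \<subseteq> carrier G \<and> (\<forall>x\<in>carrier G. \<exists>d\<in>D. x \<in> d <# U)))"

lemma narrowE:
  assumes narrow "unit_nhd U"
  obtains D where "countable D" "D \<subseteq> carrier G" "\<And>x. x \<in> carrier G \<Longrightarrow> \<exists>d\<in>D. x \<in> d <# U"
proof -
  have "\<exists>D. countable D \<and> D \<subseteq> carrier G \<and> (\<forall>x\<in>carrier G. \<exists>d\<in>D. x \<in> d <# U)"
    using assms unfolding narrow_def by simp
  then show thesis using that by meson
qed

text \<open>
  If \<open>WWW \<subseteq> U\<close> for a symmetric \<open>W\<close> and \<open>x\<inverse> = d w\<close> with \<open>w \<in> W\<close>, then
  \<open>x v x\<inverse> = w\<inverse> (d\<inverse> v d) w\<close>, so it suffices that \<open>d\<inverse> v d \<in> W\<close>. Countably many \<open>d\<close>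
  are enough.
\<close>

lemma narrow_conjugates:
  assumes n: narrow and U: "unit_nhd U"
  obtains \<V> where "countable \<V>" "\<And>V. V \<in> \<V> \<Longrightarrow> unit_nhd V"
    "\<And>x. x \<in> carrier G \<Longrightarrow> \<exists>V\<in>\<V>. \<forall>v\<in>V. x \<otimes> v \<otimes> inv x \<in> U"
proof -
  obtain W1 where W1: "unit_nhd W1" "W1 \<subseteq> U" "\<And>x. x \<in> W1 \<Longrightarrow> inv x \<in> W1"
     "\<And>x y. x \<in> W1 \<Longrightarrow> y \<in> W1 \<Longrightarrow> x \<otimes> y \<in> U"
    using unit_nhd_symmetric_root[OF U] by blast
  obtain W where W: "unit_nhd W" "W \<subseteq> W1" "\<And>x. x \<in> W \<Longrightarrow> inv x \<in> W"
     "\<And>x y. x \<in> W \<Longrightarrow> y \<in> W \<Longrightarrow> x \<otimes> y \<in> W1"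
    using unit_nhd_symmetric_root[OF W1(1)] by blast
  have Wc: "W \<subseteq> carrier G" using W(1) unit_nhd_subset by blast
  obtain D where D: "countable D" "D \<subseteq> carrier G" "\<And>x. x \<in> carrier G \<Longrightarrow> \<exists>d\<in>D. x \<in> d <# W"
    using narrowE[OF n W(1)] by blast
  define V where "V d = {v \<in> carrier G. inv d \<otimes> (v \<otimes> d) \<in> W}" for d
  show thesis
  proof
    show "countable (V ` D)" using D(1) by simp
    show "unit_nhd Q" if Q: "Q \<in> V ` D" for Q
    proof -
      obtain d where "Q = V d" "d \<in> D" using Q by (rule imageE)
      then have d: "d \<in> carrier G" "Q = V d" using D(2) by auto
      have "continuous_map T T (\<lambda>v. inv d \<otimes> (v \<otimes> d))"
        using continuous_map_compose[OF continuous_map_right_mult[OF d(1)] continuous_map_left_mult[of "inv d"]] d(1)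
        by (simp add: o_def)
      then have "openin T (V d)" unfolding V_def using W(1) by (intro open_preimage) (auto simp: unit_nhd_def)
      then show ?thesis using W(1) d by (simp add: unit_nhd_def V_def)
    qed
    fix x assume x: "x \<in> carrier G"
    then obtain d where d: "d \<in> D" "inv x \<in> d <# W" using D(3) inv_closed by blast
    have dc: "d \<in> carrier G" using d(1) D(2) by blast
    have w: "inv d \<otimes> inv x \<in> W" using d(2) mem_l_coset_iff[OF Wc dc] by blast
    have "x \<otimes> v \<otimes> inv x \<in> U" if v: "v \<in> V d" for v
    proof -
      have vc: "v \<in> carrier G" "inv d \<otimes> (v \<otimes> d) \<in> W" using v by (auto simp: V_def)
      have "inv (inv d \<otimes> inv x) \<otimes> (inv d \<otimes> (v \<otimes> d)) \<in> W1" using W(3,4) w vc(2) by blast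
      moreover have "inv d \<otimes> inv x \<in> W1" using w W(2) by blast
      ultimately have "inv (inv d \<otimes> inv x) \<otimes> (inv d \<otimes> (v \<otimes> d)) \<otimes> (inv d \<otimes> inv x) \<in> U"
        using W1(4) by blast
      moreover have "inv (inv d \<otimes> inv x) \<otimes> (inv d \<otimes> (v \<otimes> d)) \<otimes> (inv d \<otimes> inv x) = x \<otimes> v \<otimes> inv x"
        using x dc vc(1) by (simp add: group_simps)
      ultimately show ?thesis by simp
    qed
    then show "\<exists>V\<in>V ` D. \<forall>v\<in>V. x \<otimes> v \<otimes> inv x \<in> U" using d(1) by blast
  qed
qed

text \<open>
  Close \<open>{U}\<close> under roots, under the countably many neighbourhoods of \<open>narrow_conjugates\<close> and under
  binary intersections. Roots make the intersection a closed subgroup, conjugates make it normal, and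
  countably many translates of each of the countably many members witness countable type.
\<close>

lemma narrow_normal_filter_base:
  assumes n: narrow and U: "unit_nhd U"
  obtains \<gamma> where "countable \<gamma>" "U \<in> \<gamma>" "group_filter_base \<gamma>" "\<Inter>\<gamma> \<lhd> G" "closedin T (\<Inter>\<gamma>)"
    "countable_type b \<gamma>"
proof -
  define good where "good U \<V> \<longleftrightarrow> countable \<V> \<and> (unit_nhd U \<longrightarrow> (\<forall>V\<in>\<V>. unit_nhd V) \<and>
    (\<forall>x\<in>carrier G. \<exists>V\<in>\<V>. \<forall>v\<in>V. x \<otimes> v \<otimes> inv x \<in> U) \<and>
    (\<exists>W\<in>\<V>. \<forall>x\<in>W. \<forall>y\<in>W. x \<otimes> inv y \<in> U))" for U \<V>
  have "\<exists>\<V>. good U \<V>" for U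
  proof (cases "unit_nhd U")
    case True
    obtain \<V> where \<V>: "countable \<V>" "\<And>V. V \<in> \<V> \<Longrightarrow> unit_nhd V"
      "\<And>x. x \<in> carrier G \<Longrightarrow> \<exists>V\<in>\<V>. \<forall>v\<in>V. x \<otimes> v \<otimes> inv x \<in> U"
      using narrow_conjugates[OF n True] by blast
    obtain W where W: "unit_nhd W" "W \<subseteq> U" "\<And>x. x \<in> W \<Longrightarrow> inv x \<in> W"
       "\<And>x y. x \<in> W \<Longrightarrow> y \<in> W \<Longrightarrow> x \<otimes> y \<in> U"
      using unit_nhd_symmetric_root[OF True] by blast
    have "good U (insert W \<V>)"
      unfolding good_def using \<V> W(1) W(4)[OF _ W(3)] by (simp del: ball_simps) blast
    then show ?thesis by blast
  qed (intro exI[of _ "{}"], simp add: good_def)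
  then obtain g where "\<And>V. good V (g V)" by metis
  then have g: "\<And>V. countable (g V)" "\<And>V W. unit_nhd V \<Longrightarrow> W \<in> g V \<Longrightarrow> unit_nhd W"
    "\<And>V x. unit_nhd V \<Longrightarrow> x \<in> carrier G \<Longrightarrow> \<exists>W\<in>g V. \<forall>v\<in>W. x \<otimes> v \<otimes> inv x \<in> V"
    "\<And>V. unit_nhd V \<Longrightarrow> \<exists>W\<in>g V. \<forall>x\<in>W. \<forall>y\<in>W. x \<otimes> inv y \<in> V"
    unfolding good_def by simp_all
  define \<gamma> where "\<gamma> = (\<Union>n. refinements g U n)"
  have count: "countable \<gamma>" unfolding \<gamma>_def by (rule countable_UN) (simp_all add: countable_refinements[OF g(1)])
  have U\<gamma>: "U \<in> \<gamma>" unfolding \<gamma>_def by (rule UN_I[of 0]) simp_all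
  have "\<forall>V\<in>refinements g U n. unit_nhd V" for n
  proof (induction n)
    case 0 then show ?case using U by simp
  next
    case (Suc n) then show ?case using g(2) unit_nhd_Int by auto
  qed
  then have nhd: "unit_nhd V" if "V \<in> \<gamma>" for V using that unfolding \<gamma>_def by blast
  have g\<gamma>: "g V \<subseteq> \<gamma>" if V: "V \<in> \<gamma>" for V
  proof -
    obtain n where "V \<in> refinements g U n" using V unfolding \<gamma>_def by blast
    then have "g V \<subseteq> refinements g U (Suc n)" by auto
    then show ?thesis unfolding \<gamma>_def by blast
  qed
  have Int\<gamma>: "V \<inter> W \<in> \<gamma>" if VW: "V \<in> \<gamma>" "W \<in> \<gamma>" for V W
  proof -
    obtain m n where mn: "V \<in> refinements g U m" "W \<in> refinements g U n" using VW unfolding \<gamma>_def by blast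
    define k where "k = max m n"
    have "V \<in> refinements g U k" "W \<in> refinements g U k"
      using mn refinements_mono[of m k g U] refinements_mono[of n k g U] by (auto simp: k_def)
    then have "V \<inter> W \<in> (\<lambda>(V, W). V \<inter> W) ` (refinements g U k \<times> refinements g U k)"
      by (intro image_eqI[of _ _ "(V, W)"]) auto
    then have "V \<inter> W \<in> refinements g U (Suc k)" by simp
    then show ?thesis unfolding \<gamma>_def by blast
  qed
  have root: "\<exists>W\<in>\<gamma>. \<forall>x\<in>W. \<forall>y\<in>W. x \<otimes> inv y \<in> V" if "V \<in> \<gamma>" for V
    using g(4)[OF nhd[OF that]] g\<gamma>[OF that] by blast
  have base: "group_filter_base \<gamma>"
    unfolding group_filter_base_def
  proof (intro conjI ballI)
    show "\<gamma> \<noteq> {}" using U\<gamma> by blast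
    show "\<exists>U\<in>\<gamma>. U \<subseteq> V \<inter> W" if "V \<in> \<gamma>" "W \<in> \<gamma>" for V W using Int\<gamma>[OF that] by blast
  qed (use nhd root in auto)
  have Ac: "\<Inter>\<gamma> \<subseteq> carrier G" using U\<gamma> unit_nhd_subset[OF U] by blast
  have one: "\<one> \<in> \<Inter>\<gamma>" using nhd by (auto simp: unit_nhd_def)
  have quot: "x \<otimes> inv y \<in> \<Inter>\<gamma>" if "x \<in> \<Inter>\<gamma>" "y \<in> \<Inter>\<gamma>" for x y
    using root that by blast
  have minv: "inv x \<in> \<Inter>\<gamma>" if "x \<in> \<Inter>\<gamma>" for x
    using quot[OF one that] that Ac by (simp add: subset_iff del: Inter_iff)
  have mult: "x \<otimes> y \<in> \<Inter>\<gamma>" if "x \<in> \<Inter>\<gamma>" "y \<in> \<Inter>\<gamma>" for x y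
    using quot[OF that(1) minv[OF that(2)]] that Ac by (simp add: subset_iff del: Inter_iff)
  have sg: "subgroup (\<Inter>\<gamma>) G"
    using Ac one mult minv by (intro subgroup.intro)
  have conj: "x \<otimes> h \<otimes> inv x \<in> \<Inter>\<gamma>" if x: "x \<in> carrier G" and h: "h \<in> \<Inter>\<gamma>" for x h
  proof
    fix V assume V: "V \<in> \<gamma>"
    obtain W where W: "W \<in> g V" "\<forall>v\<in>W. x \<otimes> v \<otimes> inv x \<in> V" using g(3)[OF nhd[OF V] x] by blast
    then show "x \<otimes> h \<otimes> inv x \<in> V" using h g\<gamma>[OF V] by blast
  qed
  have normal: "\<Inter>\<gamma> \<lhd> G"
    unfolding normal_inv_iff using sg conj by blast
  have cl: "\<exists>W\<in>\<gamma>. T closure_of W \<subseteq> V" if V: "V \<in> \<gamma>" for V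
  proof -
    obtain W where W: "W \<in> \<gamma>" "\<forall>x\<in>W. \<forall>y\<in>W. x \<otimes> inv y \<in> V" using root[OF V] by blast
    then have "T closure_of W \<subseteq> V" by (intro closure_of_root_subset nhd) simp_all
    then show ?thesis using W(1) by blast
  qed
  have closed: "closedin T (\<Inter>\<gamma>)"
  proof -
    have "\<Inter>\<gamma> = (\<Inter>V\<in>\<gamma>. T closure_of V)"
    proof
      show "\<Inter>\<gamma> \<subseteq> (\<Inter>V\<in>\<gamma>. T closure_of V)"
        using closure_of_subset[of _ T] unit_nhd_subset[OF nhd] topspace_eq by blast
      show "(\<Inter>V\<in>\<gamma>. T closure_of V) \<subseteq> \<Inter>\<gamma>" using cl by blast
    qed
    moreover have "closedin T (\<Inter>V\<in>\<gamma>. T closure_of V)" using U\<gamma> by (intro closedin_INT) auto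
    ultimately show ?thesis by simp
  qed
  have "\<exists>D. countable D \<and> D \<subseteq> carrier G \<and> (V \<in> \<gamma> \<longrightarrow> (\<forall>x\<in>carrier G. \<exists>d\<in>D. x \<in> d <# V))" for V
  proof (cases "V \<in> \<gamma>")
    case True
    then show ?thesis using n nhd unfolding narrow_def by simp
  qed (intro exI[of _ "{}"], simp)
  then obtain D where D: "\<And>V. countable (D V)" "\<And>V. D V \<subseteq> carrier G"
    "\<And>V x. V \<in> \<gamma> \<Longrightarrow> x \<in> carrier G \<Longrightarrow> \<exists>d\<in>D V. x \<in> d <# V"
    by metis
  have ct: "countable_type b \<gamma>"
    unfolding countable_type_def
  proof (intro exI[of _ "\<Union>V\<in>\<gamma>. (\<lambda>d. d <# V) ` D V"] conjI ballI impI)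
    show "countable (\<Union>V\<in>\<gamma>. (\<lambda>d. d <# V) ` D V)" using count D(1) by simp
    show "openin T S" if "S \<in> (\<Union>V\<in>\<gamma>. (\<lambda>d. d <# V) ` D V)" for S
      using that open_l_coset nhd D(2) by (fastforce simp: unit_nhd_def subset_iff)
    fix x V assume x: "x \<in> carrier G" and V: "V \<in> \<gamma>"
    obtain W where W: "W \<in> \<gamma>" "W \<subseteq> V" "\<And>x y z. x \<in> W \<Longrightarrow> y \<in> W \<Longrightarrow> z \<in> W \<Longrightarrow> inv x \<otimes> (y \<otimes> z) \<in> V"
      using group_filter_base_root[OF base V] by blast
    have c: "W \<subseteq> carrier G" "\<one> \<in> W" "V \<subseteq> carrier G"
      using nhd W(1) V unit_nhd_subset by (auto simp: unit_nhd_def)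
    obtain d where d: "d \<in> D W" "x \<in> d <# W" using D(3)[OF W(1) x] by blast
    have dc: "d \<in> carrier G" using d(1) D(2) by blast
    have "d <# W \<subseteq> x <# V"
    proof
      fix y assume "y \<in> d <# W"
      then have y: "y \<in> carrier G" "inv d \<otimes> y \<in> W" using mem_l_coset_iff[OF c(1) dc] by auto
      have "inv d \<otimes> x \<in> W" using d(2) mem_l_coset_iff[OF c(1) dc] by auto
      then have "inv (inv d \<otimes> x) \<otimes> ((inv d \<otimes> y) \<otimes> \<one>) \<in> V" using W(3) y(2) c(2) by blast
      then have "inv x \<otimes> y \<in> V" using x y(1) dc by (simp add: group_simps)
      then show "y \<in> x <# V" using mem_l_coset_iff[OF c(3) x] y(1) by blast
    qed
    then show "\<exists>S\<in>\<Union>V\<in>\<gamma>. (\<lambda>d. d <# V) ` D V. x \<in> S \<and> S \<subseteq> x <# V"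
      using d W(1) by (intro bexI[of _ "d <# W"]) auto
  qed
  show thesis using that[OF count U\<gamma> base normal closed ct] .
qed

section \<open>Lifting a lattice of subgroups along a compact subgroup\<close>

text \<open>
  These are the kernels of the lattice on \<open>G\<close>.
\<close>

definition compact_lift :: "'a set \<Rightarrow> bool \<Rightarrow> 'a set set \<Rightarrow> 'a set set" where
  "compact_lift K b \<H> =
     {N. N \<lhd> G \<and> closedin T N \<and> N <#> K \<in> \<H> \<and> countable_type b (quotient_base N)}"

lemma quotient_base_filter_base: "N \<lhd> G \<Longrightarrow> group_filter_base (quotient_base N)"
  using quotient_bases_filter_base[of "\<lambda>_. N"] by (simp add: decseq_def)

lemma Inter_quotient_base: "N \<lhd> G \<Longrightarrow> closedin T N \<Longrightarrow> \<Inter>(quotient_base N) = N"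
  using Inter_quotient_bases[of "\<lambda>_. N"] by simp

text \<open>
  \<open>G/(A \<inter> B)\<close> is of countable type because it embeds into \<open>G/A \<times> G/B\<close>.
\<close>

lemma countable_type_quotient_Int:
  assumes A: "A \<lhd> G" "closedin T A" "countable_type b (quotient_base A)"
    and B: "B \<lhd> G" "closedin T B" "countable_type b (quotient_base B)"
    and K: "compactin T K" and BK: "B \<subseteq> K <#> (A \<inter> B)"
  shows "countable_type b (quotient_base (A \<inter> B))"
proof (rule countable_type_compact_extension[OF quotient_base_filter_base[OF A(1)] A(3) K])
  show "subgroup B G" "subgroup (A \<inter> B) G"
    using A(1) B(1) normal_Int normal_imp_subgroup by blast+
qed (use B BK Inter_quotient_base[OF A(1,2)] in auto)

text \<open>
  The way in which members of the lifted family arise: cut a coarse quotient given by \<open>\<gamma>\<close> with a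
  member \<open>H\<close> of \<open>\<H>\<close> so small that \<open>NK = H\<close> for \<open>N = \<Inter>\<gamma> \<inter> H\<close>.
\<close>

lemma compact_lift_refine:
  assumes L: "subgroup_lattice K b \<H>" and K: "K \<lhd> G" "compactin T K" and \<gamma>: "group_filter_base \<gamma>"
    "countable_type b \<gamma>" "\<Inter>\<gamma> \<lhd> G" "closedin T (\<Inter>\<gamma>)"
    and H: "H \<in> \<H>" "H \<subseteq> \<Inter>\<gamma> <#> K"
  shows "\<Inter>\<gamma> \<inter> H \<in> compact_lift K b \<H>"
proof -
  note H' = subgroup_lattice_member[OF L H(1)]
  have sg: "subgroup (\<Inter>\<gamma>) G" "subgroup H G" "subgroup (\<Inter>\<gamma> \<inter> H) G" "\<Inter>\<gamma> \<inter> H \<lhd> G"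
    using \<gamma>(3) H'(1) normal_Int normal_imp_subgroup by blast+
  have NK: "(\<Inter>\<gamma> \<inter> H) <#> K = H" using Int_set_mult_eq[OF sg(1,2) H'(3) H(2)] .
  have "countable_type b (quotient_base (\<Inter>\<gamma> \<inter> H))"
  proof (rule countable_type_compact_extension[OF \<gamma>(1,2) K(2) sg(2) H'(2,4) sg(3)])
    show "H \<subseteq> K <#> (\<Inter>\<gamma> \<inter> H)" using NK commut_normal[OF sg(3) K(1)] by simp
  qed auto
  moreover have "closedin T (\<Inter>\<gamma> \<inter> H)" using \<gamma>(4) H'(2) by (rule closedin_Int)
  ultimately show ?thesis
    unfolding compact_lift_def using sg(4) NK H(1) by simp
qed

text \<open>
  The core of the theorem, free of topologies on quotients.
\<close>

lemma subgroup_lattice_compact_lift: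
  assumes L: "subgroup_lattice K b \<H>" and K: "K \<lhd> G" "compactin T K"
  shows "subgroup_lattice {\<one>} b (compact_lift K b \<H>)"
proof -
  interpret K: normal K G by (rule K)
  let ?\<N> = "compact_lift K b \<H>"
  have mem: "N \<lhd> G" "subgroup N G" "closedin T N" "N <#> K \<in> \<H>" "countable_type b (quotient_base N)"
    if "N \<in> ?\<N>" for N
    using that normal_imp_subgroup unfolding compact_lift_def by blast+
  have N_sub: "N \<subseteq> N <#> K" if "N \<in> ?\<N>" for N
    using subset_set_mult_left[OF K.one_closed] mem(2)[OF that] subgroup.subset by blast
  have narrow: narrow
    unfolding narrow_def using subgroup_lattice_countable_translates[OF L K] by blast
  have nhd: "\<exists>N\<in>?\<N>. \<exists>V. unit_nhd V \<and> V <#> N \<subseteq> U <#> {\<one>}" if U: "unit_nhd U" for U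
  proof -
    obtain \<gamma> where \<gamma>: "countable \<gamma>" "U \<in> \<gamma>" "group_filter_base \<gamma>" "\<Inter>\<gamma> \<lhd> G" "closedin T (\<Inter>\<gamma>)"
      "countable_type b \<gamma>"
      using narrow_normal_filter_base[OF narrow U, of b] by blast
    have \<gamma>n: "unit_nhd V" if "V \<in> \<gamma>" for V using \<gamma>(3) that by (simp add: group_filter_base_def)
    have "contains_unit_G_delta (\<Inter>\<gamma>)"
      using \<gamma>(1) \<gamma>n by (rule contains_unit_G_delta_countable) auto
    then obtain H where H: "H \<in> \<H>" "H \<subseteq> \<Inter>\<gamma> <#> K"
      using subgroup_lattice_below_G_delta[OF L K(2)] by blast
    have N: "\<Inter>\<gamma> \<inter> H \<in> ?\<N>"
      using compact_lift_refine[OF L K \<gamma>(3,6,4,5) H] .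
    obtain W where W: "W \<in> \<gamma>" "W \<subseteq> U" "\<And>x y z. x \<in> W \<Longrightarrow> y \<in> W \<Longrightarrow> z \<in> W \<Longrightarrow> inv x \<otimes> (y \<otimes> z) \<in> U"
      using group_filter_base_root[OF \<gamma>(3,2)] by blast
    have Wc: "W \<subseteq> carrier G" using unit_nhd_subset[OF \<gamma>n[OF W(1)]] .
    have "W <#> (\<Inter>\<gamma> \<inter> H) \<subseteq> U"
    proof
      fix x assume "x \<in> W <#> (\<Inter>\<gamma> \<inter> H)"
      then obtain w n where wn: "w \<in> W" "n \<in> W" "x = w \<otimes> n" using W(1) by (auto elim!: set_mult_memE)
      have "inv \<one> \<otimes> (w \<otimes> n) \<in> U" using W(3)[OF _ wn(1,2)] \<gamma>n[OF W(1)] unfolding unit_nhd_def by blast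
      then show "x \<in> U" using wn Wc by (simp add: subset_iff)
    qed
    also have "U \<subseteq> U <#> {\<one>}" using subset_set_mult_left[of "{\<one>}" U] unit_nhd_subset[OF U] by simp
    finally show ?thesis using N \<gamma>n[OF W(1)] by blast
  qed
  have inter: "\<exists>N\<in>?\<N>. N \<subseteq> N1 \<inter> N2" if N1: "N1 \<in> ?\<N>" and N2: "N2 \<in> ?\<N>" for N1 N2
  proof -
    have "contains_unit_G_delta (N1 \<inter> N2)"
      using contains_unit_G_delta_Int contains_unit_G_delta_of_countable_type mem(1,3,5) N1 N2 by blast
    then obtain H where H: "H \<in> \<H>" "H \<subseteq> (N1 \<inter> N2) <#> K"
      using subgroup_lattice_below_G_delta[OF L K(2)] by blast
    note H' = subgroup_lattice_member[OF L H(1)]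
    have HN1: "H \<subseteq> N1 <#> K" using H(2) set_mult_left_mono[of "N1 \<inter> N2" N1 K] by blast
    have M: "N1 \<inter> H \<in> ?\<N>"
      using compact_lift_refine[OF L K quotient_base_filter_base[OF mem(1)[OF N1]] mem(5)[OF N1]]
        H(1) HN1 Inter_quotient_base[OF mem(1,3)[OF N1]] mem(1,3)[OF N1] by simp
    have sg: "subgroup (N1 \<inter> N2) G" "subgroup H G" "N1 \<inter> N2 \<lhd> G" "subgroup (N1 \<inter> N2 \<inter> H) G" "N1 \<inter> N2 \<inter> H \<lhd> G"
      using mem(1)[OF N1] mem(1)[OF N2] H'(1) normal_Int normal_imp_subgroup by blast+
    have NK: "(N1 \<inter> N2 \<inter> H) <#> K = H" using Int_set_mult_eq[OF sg(1,2) H'(3) H(2)] .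
    have eq: "N2 \<inter> (N1 \<inter> H) = N1 \<inter> N2 \<inter> H" by blast
    \<comment> \<open>Countable type is obtained in two steps, for \<open>N1 \<inter> H\<close> and then for its intersection with \<open>N2\<close>,
      since each application of the embedding adds one factor.\<close>
    have "N1 \<inter> H \<subseteq> K <#> (N2 \<inter> (N1 \<inter> H))"
      using NK commut_normal[OF sg(4) K(1)] eq by auto
    then have "countable_type b (quotient_base (N2 \<inter> (N1 \<inter> H)))"
      using countable_type_quotient_Int[OF mem(1,3,5)[OF N2] mem(1,3,5)[OF M] K(2)] by blast
    moreover have "closedin T (N1 \<inter> N2 \<inter> H)"
      using mem(3)[OF N1] mem(3)[OF N2] H'(2) by (intro closedin_Int)
    ultimately have "N1 \<inter> N2 \<inter> H \<in> ?\<N>"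
      unfolding compact_lift_def using eq sg(5) NK H(1) by simp
    then show ?thesis by (rule bexI[rotated]) auto
  qed
  have seq: "(\<Inter>n. N n) \<in> ?\<N> \<and>
        (\<forall>U. unit_nhd U \<longrightarrow> (\<exists>n V. unit_nhd V \<and> V <#> N n \<subseteq> U <#> (\<Inter>n. N n))) \<and>
        (\<forall>x. (\<forall>n. x n \<in> carrier G) \<and> (\<forall>k n. k < n \<longrightarrow> x n \<in> x k <# N k) \<longrightarrow>
           (\<exists>z\<in>carrier G. \<forall>n. z \<in> x n <# N n))"
    if N: "\<And>n::nat. N n \<in> ?\<N>" and dec: "decseq N" for N
  proof -
    define H where "H n = N n <#> K" for n
    have H: "H n \<in> \<H>" for n unfolding H_def using mem(4)[OF N] .
    have decH: "decseq H" using dec unfolding decseq_def H_def by (auto intro: set_mult_left_mono[THEN subsetD])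
    have normN: "(\<Inter>n. N n) \<lhd> G"
      unfolding normal_inv_iff using subgroups_Inter[of "range N"] mem(2)[OF N] mem(1)[OF N]
      by (auto simp: normal_inv_iff)
    have sgN: "subgroup (\<Inter>n. N n) G" using normN normal_imp_subgroup by blast
    have closedN: "closedin T (\<Inter>n. N n)" using mem(3)[OF N] by (intro closedin_INT) auto
    have NK: "(\<Inter>n. N n) <#> K = (\<Inter>n. H n)"
    proof
      show "(\<Inter>n. N n) <#> K \<subseteq> (\<Inter>n. H n)"
        unfolding H_def by (intro INT_greatest set_mult_left_mono) auto
      show "(\<Inter>n. H n) \<subseteq> (\<Inter>n. N n) <#> K"
      proof
        fix x assume "x \<in> (\<Inter>n. H n)"
        then have "x \<in> N n <#> K" for n by (simp add: H_def)
        then show "x \<in> (\<Inter>n. N n) <#> K" by (rule compact_set_mult_Inter[OF K(2) mem(3)[OF N] dec])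
      qed
    qed
    have HI: "(\<Inter>n. H n) \<in> \<H>" using subgroup_lattice_decseq(1)[OF L H decH] .
    note HI' = subgroup_lattice_member[OF L HI]
    have top: "\<exists>n V. unit_nhd V \<and> V <#> N n \<subseteq> U <#> (\<Inter>n. N n)" if U: "unit_nhd U" for U
    proof -
      have "(\<Inter>n. H n) \<subseteq> K <#> (\<Inter>n. N n)" using NK commut_normal[OF sgN K(1)] by simp
      moreover have "(\<Inter>n. N n) \<subseteq> (\<Inter>n. H n)"
        using N_sub[OF N] unfolding H_def by (intro INT_greatest) blast
      ultimately obtain W V where W: "unit_nhd W" "V \<in> (\<Union>n. quotient_base (N n))"
        "(W <#> (\<Inter>n. H n)) \<inter> V \<subseteq> U <#> (\<Inter>n. N n)"
        using compact_extension_separation[OF quotient_bases_filter_base[OF mem(1)[OF N] dec] K(2)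
          normal_imp_subgroup[OF HI'(1)] HI'(2) sgN] U Inter_quotient_bases[of N, OF mem(1)[OF N] mem(3)[OF N]]
        by (metis Int_lower2 order_refl)
      \<comment> \<open>The factor \<open>V\<close> comes from some \<open>G/N n\<close>, and \<open>W\<close> from some \<open>G/H m\<close> by the topological clause
        for \<open>\<H>\<close>; the larger index serves both.\<close>
      obtain n V' where V': "unit_nhd V'" "V = V' <#> N n" using W(2) by (auto simp: quotient_base_def)
      obtain m W' where W': "unit_nhd W'" "W' <#> H m \<subseteq> W <#> (\<Inter>n. H n)"
        using subgroup_lattice_decseq(2)[OF L H decH W(1)] by blast
      have "N (max n m) \<subseteq> N n" "N (max n m) \<subseteq> N m" using dec by (auto simp: decseq_def)
      then have "N (max n m) \<subseteq> N n" "N (max n m) \<subseteq> H m" using N_sub[OF N[of m]] by (auto simp: H_def)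
      then have "(V' \<inter> W') <#> N (max n m) \<subseteq> V' <#> N n" "(V' \<inter> W') <#> N (max n m) \<subseteq> W' <#> H m"
        by (simp_all add: mono_set_mult)
      then have "(V' \<inter> W') <#> N (max n m) \<subseteq> U <#> (\<Inter>n. N n)" using W'(2) W(3) V'(2) by blast
      then show ?thesis using unit_nhd_Int[OF V'(1) W'(1)] by blast
    qed
    have "countable_type b (quotient_base (\<Inter>n. N n))"
    proof (rule countable_type_UN[OF mem(5)[OF N]])
      fix U assume "U \<in> quotient_base (\<Inter>n. N n)"
      then obtain U' where U': "unit_nhd U'" "U = U' <#> (\<Inter>n. N n)" by (auto simp: quotient_base_def)
      then obtain n V where "unit_nhd V" "V <#> N n \<subseteq> U" using top by blast
      then show "\<exists>n. \<exists>V\<in>quotient_base (N n). V \<subseteq> U" by (auto simp: quotient_base_def)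
    qed
    then have "(\<Inter>n. N n) \<in> ?\<N>"
      unfolding compact_lift_def using normN closedN NK HI by simp
    moreover have "\<exists>z\<in>carrier G. \<forall>n. z \<in> x n <# N n"
      if x: "\<And>n. x n \<in> carrier G" "\<And>k n. k < n \<Longrightarrow> x n \<in> x k <# N k" for x
    proof -
      have Nc: "N n \<subseteq> carrier G" for n using subgroup.subset[OF mem(2)[OF N]] .
      have xH: "x n \<in> x k <# H k" if "k < n" for k n
        using x(2)[OF that] l_coset_mono[OF N_sub[OF N[of k]]] by (auto simp: H_def)
      then obtain y where y: "y \<in> carrier G" "\<And>n. y \<in> x n <# H n"
        using subgroup_lattice_decseq(3)[OF L H decH x(1) xH] by meson
      \<comment> \<open>Completeness of \<open>\<H>\<close> gives \<open>y\<close> only up to \<open>K\<close>; the compact coset \<open>yK\<close> meets all the decreasing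
        closed cosets \<open>x n <# N n\<close>, hence their intersection.\<close>
      have "y \<in> (x n <# N n) <#> K" for n
      proof -
        obtain h where h: "h \<in> H n" "y = x n \<otimes> h" using y(2)[of n] unfolding l_coset_def by blast
        obtain a k where ak: "a \<in> N n" "k \<in> K" "h = a \<otimes> k" using h(1) unfolding H_def by (rule set_mult_memE)
        have "y = (x n \<otimes> a) \<otimes> k" using h(2) ak x(1)[of n] Nc[of n] K.subset by (simp add: m_assoc subset_iff)
        moreover have "x n \<otimes> a \<in> x n <# N n" using ak(1) unfolding l_coset_def by blast
        ultimately show ?thesis using ak(2) set_mult_memI by simp
      qed
      moreover have "closedin T (x n <# N n)" for n
      proof -
        have "x n <# N n = {z \<in> carrier G. inv (x n) \<otimes> z \<in> N n}"
          using mem_l_coset_iff[OF Nc x(1)] by blast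
        then show ?thesis
          using closed_preimage[OF continuous_map_left_mult[of "inv (x n)"] mem(3)[OF N]] x(1) by simp
      qed
      moreover have "decseq (\<lambda>n. x n <# N n)"
        unfolding decseq_Suc_iff
      proof
        fix n
        show "x (Suc n) <# N (Suc n) \<subseteq> x n <# N n"
        proof
          fix z assume "z \<in> x (Suc n) <# N (Suc n)"
          then obtain a where a: "a \<in> N (Suc n)" "z = x (Suc n) \<otimes> a" by (auto simp: l_coset_def)
          obtain c where c: "c \<in> N n" "x (Suc n) = x n \<otimes> c" using x(2)[of n "Suc n"] by (auto simp: l_coset_def)
          have "a \<in> N n" using a(1) dec by (auto simp: decseq_Suc_iff)
          then have "c \<otimes> a \<in> N n" using c(1) subgroup.m_closed[OF mem(2)[OF N]] by blast
          moreover have "z = x n \<otimes> (c \<otimes> a)" using a c x(1) Nc \<open>a \<in> N n\<close> by (simp add: m_assoc subset_iff)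
          ultimately show "z \<in> x n <# N n" by (auto simp: l_coset_def)
        qed
      qed
      ultimately have "y \<in> (\<Inter>n. x n <# N n) <#> K" by (intro compact_set_mult_Inter[OF K(2)])
      then obtain z k where "z \<in> (\<Inter>n. x n <# N n)" "k \<in> K" "y = z \<otimes> k" by (rule set_mult_memE)
      moreover from this have "z \<in> carrier G" using mem_l_coset_iff[OF Nc x(1)] by blast
      ultimately show ?thesis by blast
    qed
    ultimately show ?thesis using top by blast
  qed
  show ?thesis
    unfolding subgroup_lattice_def
  proof (intro conjI)
    show "\<forall>N\<in>?\<N>. N \<lhd> G \<and> closedin T N \<and> {\<one>} \<subseteq> N \<and> countable_type b (quotient_base N)"
      using mem subgroup.one_closed by blast
    show "\<forall>U. unit_nhd U \<longrightarrow> (\<exists>H\<in>?\<N>. \<exists>V. unit_nhd V \<and> V <#> H \<subseteq> U <#> {\<one>})" using nhd by blast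
    show "\<forall>H\<in>?\<N>. \<forall>H'\<in>?\<N>. \<exists>L\<in>?\<N>. L \<subseteq> H \<inter> H'" using inter by blast
  next
    show "\<forall>H. range H \<subseteq> ?\<N> \<and> decseq H \<longrightarrow>
        (\<Inter>n. H n) \<in> ?\<N> \<and>
        (\<forall>U. unit_nhd U \<longrightarrow> (\<exists>n V. unit_nhd V \<and> V <#> H n \<subseteq> U <#> (\<Inter>n. H n))) \<and>
        (\<forall>x. (\<forall>n. x n \<in> carrier G) \<and> (\<forall>k n. k < n \<longrightarrow> x n \<in> x k <# H k) \<longrightarrow>
           (\<exists>z\<in>carrier G. \<forall>n. z \<in> x n <# H n))"
      using seq by (simp add: range_subsetD)
  qed
qed

section \<open>From open homomorphisms to subgroups\<close>

text \<open>
  Right cosets, used by \<open>G Mod N\<close>, agree with the left cosets used for \<open>countable_type\<close> because \<open>N\<close>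
  is normal.
\<close>

lemma rcos_eq_iff:
  assumes N: "N \<lhd> G" and x: "x \<in> carrier G" and y: "y \<in> carrier G"
  shows "N #> x = N #> y \<longleftrightarrow> inv x \<otimes> y \<in> N"
proof -
  interpret N: normal N G by (rule N)
  have eq: "N #> z = z <# N" if "z \<in> carrier G" for z using N.coset_eq that by simp
  have "y \<in> y <# N" using mem_l_coset_iff[OF N.subset y] y by simp
  then have "x <# N = y <# N \<longleftrightarrow> y \<in> x <# N"
    using l_repr_independence[OF _ x N.subgroup_axioms] by auto
  then show ?thesis using eq[OF x] eq[OF y] mem_l_coset_iff[OF N.subset x] y by simp
qed

lemma topspace_quotient_group_topology: "topspace (quotient_group_topology G T N) = carrier (G Mod N)"
  using quotient_imp_surjective_map[OF quotient_map_quotient_group_topology[OF topspace_eq], of N] topspace_eq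
  unfolding carrier_FactGroup by simp

lemma continuous_map_quotient_group: "continuous_map T (quotient_group_topology G T N) (\<lambda>x. N #> x)"
  using quotient_imp_continuous_map[OF quotient_map_quotient_group_topology[OF topspace_eq]] .

text \<open>
  The saturation of an open set \<open>U\<close> is \<open>UN\<close>, a union of translates of \<open>U\<close>.
\<close>

lemma open_map_quotient_group:
  assumes N: "N \<lhd> G"
  shows "open_map T (quotient_group_topology G T N) (\<lambda>x. N #> x)"
  unfolding open_map_def openin_quotient_group_topology[OF topspace_eq]
proof (intro allI impI conjI)
  interpret N: normal N G by (rule N)
  fix U assume U: "openin T U"
  have Uc: "U \<subseteq> carrier G" using U open_subset_carrier by blast
  show "(\<lambda>x. N #> x) ` U \<subseteq> carrier (G Mod N)" using Uc by (auto simp: carrier_FactGroup)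
  have "{x \<in> carrier G. N #> x \<in> (\<lambda>x. N #> x) ` U} = U <#> N"
  proof (intro equalityI subsetI)
    fix x assume "x \<in> {x \<in> carrier G. N #> x \<in> (\<lambda>x. N #> x) ` U}"
    then obtain u where u: "x \<in> carrier G" "u \<in> U" "N #> u = N #> x" by auto
    then have "inv u \<otimes> x \<in> N" using rcos_eq_iff[OF N] Uc by blast
    moreover have "x = u \<otimes> (inv u \<otimes> x)" using u Uc by (simp add: group_simps subset_iff)
    ultimately show "x \<in> U <#> N" using u(2) set_mult_memI by metis
  next
    fix x assume "x \<in> U <#> N"
    then obtain u n where un: "u \<in> U" "n \<in> N" "x = u \<otimes> n" by (rule set_mult_memE)
    then have c: "u \<in> carrier G" "x \<in> carrier G" "inv u \<otimes> x = n" using Uc N.subset by (auto simp: group_simps subset_iff)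
    then have "N #> u = N #> x" using rcos_eq_iff[OF N c(1,2)] un by simp
    then show "x \<in> {x \<in> carrier G. N #> x \<in> (\<lambda>x. N #> x) ` U}" using un(1) c(2) by (metis (mono_tags) imageI mem_Collect_eq)
  qed
  then show "openin T {x \<in> carrier G. N #> x \<in> (\<lambda>x. N #> x) ` U}"
    using open_set_mult[OF U N.subset] by simp
qed

text \<open>
  For a homomorphism this is the kernel. It is described without the target group, since a mapping
  does not record the operation of its image.
\<close>

definition fibre_of_unit :: "('a \<Rightarrow> 'c) \<Rightarrow> 'a set" where
  "fibre_of_unit q = {x \<in> carrier G. q x = q \<one>}"

lemma open_homomorphism_quotient:
  assumes q: "open_homomorphism_onto_group G T P (q, Y)"
  shows "fibre_of_unit q \<lhd> G" "closedin T (fibre_of_unit q)" "continuous_map T Y q" "open_map T Y q"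
    "q ` carrier G = topspace Y" "P Y"
    "\<And>x y. x \<in> carrier G \<Longrightarrow> y \<in> carrier G \<Longrightarrow> q x = q y \<longleftrightarrow> inv x \<otimes> y \<in> fibre_of_unit q"
proof -
  obtain H :: "'c monoid" where H: "topological_group H Y" "P Y" "q \<in> hom G H"
    "q ` carrier G = carrier H" "continuous_map T Y q" "open_map T Y q"
    using q unfolding open_homomorphism_onto_group_def by auto
  interpret H: topological_group H Y by (rule H(1))
  interpret h: group_hom G H q using H(3) by unfold_locales
  have ker: "fibre_of_unit q = kernel G H q" by (auto simp: fibre_of_unit_def kernel_def)
  show "fibre_of_unit q \<lhd> G" unfolding ker by (rule h.normal_kernel)
  show "continuous_map T Y q" "open_map T Y q" "P Y" "q ` carrier G = topspace Y"
    using H H.topspace_eq by auto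
  have "closedin Y {\<one>\<^bsub>H\<^esub>}"
    using closedin_Hausdorff_singleton[OF H.Hausdorff] H.topspace_eq by simp
  then have "closedin T {x \<in> topspace T. q x \<in> {\<one>\<^bsub>H\<^esub>}}"
    using H(5) closedin_continuous_map_preimage by blast
  then show "closedin T (fibre_of_unit q)" unfolding ker kernel_def topspace_eq by simp
  show "q x = q y \<longleftrightarrow> inv x \<otimes> y \<in> fibre_of_unit q" if "x \<in> carrier G" "y \<in> carrier G" for x y
  proof -
    have "q (inv x \<otimes> y) = inv\<^bsub>H\<^esub> (q x) \<otimes>\<^bsub>H\<^esub> q y" using that by simp
    moreover have "inv\<^bsub>H\<^esub> (q x) \<otimes>\<^bsub>H\<^esub> q y = \<one>\<^bsub>H\<^esub> \<longleftrightarrow> q x = q y"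
      using that H.inv_solve_left'[of "\<one>\<^bsub>H\<^esub>" "q x" "q y"] by auto
    ultimately show ?thesis using that by (simp add: ker kernel_def)
  qed
qed

lemma open_homomorphism_comp_quotient:
  fixes Y :: "'c topology"
  assumes K: "K \<lhd> G"
    and p: "open_homomorphism_onto_group (G Mod K) (quotient_group_topology G T K) P (p, Y)"
  shows "open_homomorphism_onto_group G T P (\<lambda>x. p (K #> x), Y)"
proof -
  interpret K: normal K G by (rule K)
  obtain H :: "'c monoid" where H: "topological_group H Y" "P Y" "p \<in> hom (G Mod K) H"
    "p ` carrier (G Mod K) = carrier H" "continuous_map (quotient_group_topology G T K) Y p"
    "open_map (quotient_group_topology G T K) Y p"
    using p unfolding open_homomorphism_onto_group_def by auto
  have "p \<circ> (\<lambda>x. K #> x) \<in> hom G H"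
    using K.r_coset_hom_Mod H(3) by (auto simp: hom_def Pi_iff)
  moreover have "(p \<circ> (\<lambda>x. K #> x)) ` carrier G = carrier H"
    using H(4) by (simp add: carrier_FactGroup image_comp)
  moreover have "continuous_map T Y (p \<circ> (\<lambda>x. K #> x))"
    using continuous_map_compose[OF continuous_map_quotient_group H(5)] .
  moreover have "open_map T Y (p \<circ> (\<lambda>x. K #> x))"
    using open_map_compose[OF open_map_quotient_group[OF K] H(6)] .
  ultimately show ?thesis
    unfolding open_homomorphism_onto_group_def o_def using H(1,2) by auto
qed

lemma open_homomorphism_preimage:
  assumes q: "open_homomorphism_onto_group G T P (q, Y)" and W: "W \<subseteq> carrier G"
    and x: "x \<in> carrier G" "q x \<in> q ` W"
  shows "x \<in> W <#> fibre_of_unit q"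
proof -
  obtain w where w: "w \<in> W" "q w = q x" using x(2) by auto
  then have "inv w \<otimes> x \<in> fibre_of_unit q"
    using open_homomorphism_quotient(7)[OF q] W x(1) by blast
  moreover have "x = w \<otimes> (inv w \<otimes> x)" using w(1) W x(1) by (simp add: group_simps subset_iff)
  ultimately show ?thesis using w(1) set_mult_memI by metis
qed

lemma open_homomorphism_mult_fibre:
  assumes q: "open_homomorphism_onto_group G T P (q, Y)"
    and x: "x \<in> carrier G" "n \<in> fibre_of_unit q"
  shows "q (x \<otimes> n) = q x"
proof -
  have n: "n \<in> carrier G" using x(2) by (simp add: fibre_of_unit_def)
  show ?thesis using open_homomorphism_quotient(7)[OF q x(1), of "x \<otimes> n"] x n by (simp add: group_simps)
qed

text \<open>
  Pull a countable network back along \<open>q\<close>. Since \<open>q\<close> is open, \<open>q(xW)\<close> is a neighbourhood of \<open>q(x)\<close>,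
  and its preimage is \<open>xWN\<close> for the kernel \<open>N\<close>.
\<close>

lemma countable_type_of_open_homomorphism:
  assumes q: "open_homomorphism_onto_group G T (countable_network_by b) (q, Y)"
  shows "countable_type b (quotient_base (fibre_of_unit q))"
proof -
  note q' = open_homomorphism_quotient[OF q]
  interpret N: normal "fibre_of_unit q" G by (rule q'(1))
  obtain \<N> where N: "countable \<N>" "network Y \<N>" "b \<longrightarrow> (\<forall>N\<in>\<N>. openin Y N)"
    using q'(6) unfolding countable_network_by_def by blast
  define \<S> where "\<S> = (\<lambda>N. {x \<in> carrier G. q x \<in> N}) ` \<N>"
  have "countable \<S>" unfolding \<S>_def using N(1) by simp
  moreover have "b \<longrightarrow> (\<forall>S\<in>\<S>. openin T S)"
    using N(3) openin_continuous_map_preimage[OF q'(3)] topspace_eq by (auto simp: \<S>_def)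
  moreover have "\<exists>S\<in>\<S>. x \<in> S \<and> S \<subseteq> x <# V"
    if x: "x \<in> carrier G" and V: "V \<in> quotient_base (fibre_of_unit q)" for x V
  proof -
    obtain W where W: "unit_nhd W" "V = W <#> fibre_of_unit q" using V by (auto simp: quotient_base_def)
    have Wc: "W \<subseteq> carrier G" using unit_nhd_subset[OF W(1)] .
    have "openin Y (q ` (x <# W))"
      using q'(4) open_l_coset[OF _ x] W(1) by (auto simp: open_map_def unit_nhd_def)
    moreover have "x \<in> x <# W" using mem_l_coset_iff[OF Wc x] x W(1) by (simp add: unit_nhd_def)
    then have "q x \<in> q ` (x <# W)" by blast
    ultimately obtain M where M: "M \<in> \<N>" "q x \<in> M" "M \<subseteq> q ` (x <# W)"
      using N(2) unfolding network_def by meson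
    have "{y \<in> carrier G. q y \<in> M} \<subseteq> x <# V"
    proof
      fix y assume y: "y \<in> {y \<in> carrier G. q y \<in> M}"
      then have "q y \<in> q ` (x <# W)" using M(3) by blast
      then have "y \<in> (x <# W) <#> fibre_of_unit q"
        using open_homomorphism_preimage[OF q l_coset_subset_G[OF Wc x]] y by blast
      then show "y \<in> x <# V" unfolding W(2) using setmult_lcos_assoc[OF Wc N.subset x] by simp
    qed
    then show ?thesis unfolding \<S>_def using M(1,2) x by (intro bexI[of _ "{y \<in> carrier G. q y \<in> M}"]) auto
  qed
  ultimately show ?thesis unfolding countable_type_def by blast
qed

text \<open>
  Every clause of a strong \<open>\<sigma>\<close>-lattice on \<open>G/K\<close> is read off on kernels, through the composition of
  its members with the projection of \<open>G\<close> onto \<open>G/K\<close>. Openness of the members is what turns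
  inclusions of kernels back into \<open>\<prec>\<close>.
\<close>

lemma subgroup_lattice_of_strong_sigma_lattice:
  fixes L :: "('a set, 'c) mapping set"
  assumes K: "K \<lhd> G"
    and L: "strong_sigma_lattice_of_open_homs (G Mod K) (quotient_group_topology G T K) (countable_network_by b) L"
  shows "subgroup_lattice K b ((\<lambda>m. fibre_of_unit (\<lambda>x. fst m (K #> x))) ` L)"
proof -
  interpret K: normal K G by (rule K)
  let ?X = "quotient_group_topology G T K"
  let ?pi = "\<lambda>x. K #> x"
  have topX: "topspace ?X = ?pi ` carrier G" by (simp add: topspace_quotient_group_topology carrier_FactGroup)
  have piX: "?pi x \<in> topspace ?X" if "x \<in> carrier G" for x using that topX by blast
  define N where "N m = fibre_of_unit (\<lambda>x. fst m (?pi x))" for m :: "('a set, 'c) mapping"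
  have sL: "strong_sigma_lattice ?X L"
    using L by (simp add: strong_sigma_lattice_of_open_homs_def)
  have hom0: "open_homomorphism_onto_group (G Mod K) ?X (countable_network_by b) (fst m, snd m)" if "m \<in> L" for m
    using L that by (simp add: strong_sigma_lattice_of_open_homs_def)
  have hom: "open_homomorphism_onto_group G T (countable_network_by b) (\<lambda>x. fst m (?pi x), snd m)" if "m \<in> L" for m
    using open_homomorphism_comp_quotient[OF K hom0[OF that]] .
  note q = open_homomorphism_quotient[OF hom, folded N_def]
  have N_iff: "fst m (?pi x) = fst m (?pi y) \<longleftrightarrow> inv x \<otimes> y \<in> N m"
    if "m \<in> L" "x \<in> carrier G" "y \<in> carrier G" for m x y
    using q(7)[OF that] .
  have N_coset: "fst m (?pi x) = fst m (?pi y) \<longleftrightarrow> y \<in> x <# N m"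
    if "m \<in> L" "x \<in> carrier G" "y \<in> carrier G" for m x y
    using N_iff[OF that] mem_l_coset_iff[OF _ that(2)] that(3) unfolding N_def fibre_of_unit_def by auto
  have N_mem: "x \<in> N m \<longleftrightarrow> x \<in> carrier G \<and> fst m (?pi x) = fst m (?pi \<one>)" for m x
    by (simp add: N_def fibre_of_unit_def)
  have N_mult: "fst m (?pi (x \<otimes> n)) = fst m (?pi x)" if "m \<in> L" "x \<in> carrier G" "n \<in> N m" for m x n
    using open_homomorphism_mult_fibre[OF hom[OF that(1)] that(2)] that(3) unfolding N_def by blast
  have KN: "K \<subseteq> N m" for m
  proof
    fix k assume k: "k \<in> K"
    then have "?pi k = ?pi \<one>" using rcos_eq_iff[OF K, of \<one> k] K.mem_carrier by simp
    then show "k \<in> N m" using k K.mem_carrier by (simp add: N_mem)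
  qed
  have finerN: "N m \<subseteq> N m'" if "finer ?X m m'" for m m'
  proof
    fix x assume "x \<in> N m"
    then have x: "x \<in> carrier G" "fst m (?pi x) = fst m (?pi \<one>)" by (auto simp: N_mem)
    then have "fst m' (?pi x) = fst m' (?pi \<one>)"
      using finer_fibres[of ?X "fst m" "snd m" "fst m'" "snd m'"] that piX by simp
    then show "x \<in> N m'" using x by (simp add: N_mem)
  qed
  have nhd: "\<exists>m\<in>L. \<exists>V. unit_nhd V \<and> V <#> N m \<subseteq> U <#> K" if U: "unit_nhd U" for U
  proof -
    have Uc: "U \<subseteq> carrier G" using unit_nhd_subset[OF U] .
    have op: "openin ?X (?pi ` U)" using open_map_quotient_group[OF K] U by (simp add: open_map_def unit_nhd_def)
    have "?pi \<one> \<in> ?pi ` U" using U by (simp add: unit_nhd_def)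
    from strong_sigma_latticeD(1)[OF sL op this]
    obtain m V where m: "m \<in> L" "openin (snd m) V" "?pi \<one> \<in> {z \<in> topspace ?X. fst m z \<in> V}"
      "{z \<in> topspace ?X. fst m z \<in> V} \<subseteq> ?pi ` U" by fastforce
    let ?V = "{x \<in> carrier G. fst m (?pi x) \<in> V}"
    have "openin T ?V" using openin_continuous_map_preimage[OF q(3)[OF m(1)] m(2)] topspace_eq by simp
    then have "unit_nhd ?V" using m(3) by (simp add: unit_nhd_def)
    moreover have "?V <#> N m \<subseteq> U <#> K"
    proof
      fix x assume "x \<in> ?V <#> N m"
      then obtain v n where vn: "v \<in> ?V" "n \<in> N m" "x = v \<otimes> n" by (rule set_mult_memE)
      then have xc: "x \<in> carrier G" by (auto simp: N_mem)
      have "fst m (?pi x) \<in> V" using N_mult[OF m(1) _ vn(2)] vn by simp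
      then have "?pi x \<in> ?pi ` U" using m(4) piX[OF xc] by blast
      then obtain u where u: "u \<in> U" "?pi u = ?pi x" by auto
      then have "inv u \<otimes> x \<in> K" using rcos_eq_iff[OF K _ xc] Uc by blast
      moreover have "x = u \<otimes> (inv u \<otimes> x)" using u(1) Uc xc by (simp add: group_simps subset_iff)
      ultimately show "x \<in> U <#> K" using u(1) set_mult_memI by metis
    qed
    ultimately show ?thesis using m(1) by blast
  qed
  have inter: "\<exists>m''\<in>L. N m'' \<subseteq> N m \<inter> N m'" if "m \<in> L" "m' \<in> L" for m m'
    using strong_sigma_latticeD(2)[OF sL, of "{m, m'}"] finerN that by (simp add: le_inf_iff) blast
  have seq: "(\<Inter>n. H n) \<in> N ` L \<and>
        (\<forall>U. unit_nhd U \<longrightarrow> (\<exists>n V. unit_nhd V \<and> V <#> H n \<subseteq> U <#> (\<Inter>n. H n))) \<and>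
        (\<forall>x. (\<forall>n. x n \<in> carrier G) \<and> (\<forall>k n. k < n \<longrightarrow> x n \<in> x k <# H k) \<longrightarrow>
           (\<exists>z\<in>carrier G. \<forall>n. z \<in> x n <# H n))"
    if H: "range H \<subseteq> N ` L" and dec: "decseq H" for H :: "nat \<Rightarrow> 'a set"
  proof -
    have "\<exists>m. m \<in> L \<and> H n = N m" for n using H by blast
    then obtain p where p: "\<And>n. p n \<in> L" "\<And>n. H n = N (p n)" by metis
    have fin: "finer ?X (p (Suc n)) (p n)" for n
    proof -
      have co: "continuous_map ?X (snd (p i)) (fst (p i))" "open_map ?X (snd (p i)) (fst (p i))" for i
        using hom0[OF p(1)[of i]] unfolding open_homomorphism_onto_group_def by auto
      have im: "fst (p i) ` topspace ?X = topspace (snd (p i))" for i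
        using q(5)[OF p(1)[of i]] unfolding topX image_image .
      have qm: "quotient_map ?X (snd (p (Suc n))) (fst (p (Suc n)))"
        by (rule continuous_open_imp_quotient_map[OF co im])
      have fib: "fst (p n) A = fst (p n) B"
        if AB: "A \<in> topspace ?X" "B \<in> topspace ?X" "fst (p (Suc n)) A = fst (p (Suc n)) B" for A B
      proof -
        obtain x y where xy: "x \<in> carrier G" "A = ?pi x" "y \<in> carrier G" "B = ?pi y" using AB(1,2) topX by auto
        then have "inv x \<otimes> y \<in> H (Suc n)" using AB(3) N_iff[OF p(1)] p(2) by simp
        then have "inv x \<otimes> y \<in> N (p n)" using dec p(2)[of n] by (auto simp: decseq_Suc_iff)
        then show ?thesis using N_iff[OF p(1) xy(1,3)] xy by simp
      qed
      have "finer ?X (fst (p (Suc n)), snd (p (Suc n))) (fst (p n), snd (p n))"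
        by (rule finer_of_quotient_map[OF qm co(1)]) (rule fib)
      then show ?thesis by (simp only: prod.collapse)
    qed
    define d where "d = (\<lambda>z n. fst (p n) z)"
    define D where "D = subtopology (product_topology (\<lambda>n. snd (p n)) UNIV) (d ` topspace ?X)"
    have dp: "diagonal_product ?X p = (d, D)" by (simp add: diagonal_product_def d_def D_def Let_def)
    obtain m where m: "m \<in> L" "finer ?X m (d, D)" "finer ?X (d, D) m"
      using strong_sigma_latticeD(3)[OF sL, of p] p(1) fin dp by auto
    have d_eq: "d (?pi x) = d (?pi y) \<longleftrightarrow> (\<forall>n. fst (p n) (?pi x) = fst (p n) (?pi y))" for x y
      by (auto simp: d_def fun_eq_iff)
    have Nm: "N m = (\<Inter>n. H n)"
    proof (intro equalityI subsetI)
      fix x assume "x \<in> N m"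
      then have x: "x \<in> carrier G" "fst m (?pi x) = fst m (?pi \<one>)" by (auto simp: N_mem)
      then have "d (?pi x) = d (?pi \<one>)"
        using finer_fibres[of ?X "fst m" "snd m" d D] m(2) piX by simp
      then show "x \<in> (\<Inter>n. H n)" using x(1) unfolding d_eq p(2) by (simp add: N_mem)
    next
      fix x assume "x \<in> (\<Inter>n. H n)"
      then have x: "x \<in> carrier G" "d (?pi x) = d (?pi \<one>)" unfolding d_eq p(2) by (auto simp: N_mem)
      then have "fst m (?pi x) = fst m (?pi \<one>)"
        using finer_fibres[of ?X d D "fst m" "snd m"] m(3) piX by simp
      then show "x \<in> N m" using x(1) by (simp add: N_mem)
    qed
    have top: "\<exists>n V. unit_nhd V \<and> V <#> H n \<subseteq> U <#> (\<Inter>n. H n)" if U: "unit_nhd U" for U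
    proof -
      have Uc: "U \<subseteq> carrier G" using unit_nhd_subset[OF U] .
      let ?O = "(\<lambda>x. fst m (?pi x)) ` U"
      obtain h where h: "continuous_map D (snd m) h" "\<And>z. z \<in> topspace ?X \<Longrightarrow> fst m z = h (d z)"
        using m(3) unfolding finer_def by (auto simp: case_prod_beta)
      have "openin (snd m) ?O" using q(4)[OF m(1)] U by (simp add: open_map_def unit_nhd_def)
      then have "openin D {f \<in> topspace D. h f \<in> ?O}" using h(1) openin_continuous_map_preimage by blast
      then obtain Q where Q: "openin (product_topology (\<lambda>n. snd (p n)) UNIV) Q"
        "{f \<in> topspace D. h f \<in> ?O} = Q \<inter> d ` topspace ?X"
        unfolding D_def openin_subtopology by blast
      have pY: "fst (p n) z \<in> topspace (snd (p n))" if z: "z \<in> topspace ?X" for n z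
      proof -
        obtain x where "z = ?pi x" "x \<in> carrier G" using z unfolding topX by (rule imageE)
        then show ?thesis using q(5)[OF p(1)[of n]] by auto
      qed
      have dD: "d z \<in> topspace D" if z: "z \<in> topspace ?X" for z
        unfolding D_def topspace_subtopology topspace_product_topology
        using z pY[OF z] by (simp add: d_def PiE_UNIV_domain)
      have "fst m (?pi \<one>) \<in> ?O" using U by (intro imageI) (simp add: unit_nhd_def)
      then have "h (d (?pi \<one>)) \<in> ?O" using h(2)[OF piX[OF one_closed]] by (simp only:)
      then have "d (?pi \<one>) \<in> Q" using Q(2) dD[OF piX[OF one_closed]] by blast
      then obtain B where B: "finite {i. B i \<noteq> topspace (snd (p i))}" "\<And>i. openin (snd (p i)) (B i)"
        "d (?pi \<one>) \<in> Pi\<^sub>E UNIV B" "Pi\<^sub>E UNIV B \<subseteq> Q"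
        using Q(1) unfolding openin_product_topology_alt by force
      \<comment> \<open>A basic neighbourhood restricts finitely many coordinates, and all of these are determined
        by the last one because the kernels decrease.\<close>
      obtain k where k: "{i. B i \<noteq> topspace (snd (p i))} \<subseteq> {..k}"
        using B(1) finite_nat_iff_bounded_le by blast
      define V where "V = (\<Inter>i\<le>k. {x \<in> carrier G. fst (p i) (?pi x) \<in> B i})"
      have V: "unit_nhd V"
      proof -
        have "openin T {x \<in> carrier G. fst (p i) (?pi x) \<in> B i}" for i
          using openin_continuous_map_preimage[OF q(3)[OF p(1)[of i]] B(2)[of i]] topspace_eq by simp
        then have "openin T V" unfolding V_def by (intro openin_INT2) auto
        moreover have "\<one> \<in> V" using B(3) by (auto simp: V_def d_def PiE_UNIV_domain)
        ultimately show ?thesis by (simp add: unit_nhd_def)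
      qed
      have "V <#> H k \<subseteq> U <#> (\<Inter>n. H n)"
      proof
        fix x assume "x \<in> V <#> H k"
        then obtain v n where vn: "v \<in> V" "n \<in> H k" "x = v \<otimes> n" by (rule set_mult_memE)
        have vc: "v \<in> carrier G" "n \<in> carrier G" using vn(1) unit_nhd_subset[OF V] vn(2) p(2) N_mem by auto
        have xc: "x \<in> carrier G" using vn(3) vc by simp
        have "fst (p i) (?pi x) \<in> B i" for i
        proof (cases "i \<le> k")
          case True
          then have "n \<in> N (p i)" using vn(2) dec p(2)[of i] by (auto simp: decseq_def)
          then have "fst (p i) (?pi x) = fst (p i) (?pi v)" using N_mult[OF p(1) vc(1)] vn(3) by simp
          then show ?thesis using vn(1) True by (simp add: V_def)
        next
          case False
          then have "B i = topspace (snd (p i))" using k by blast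
          then show ?thesis using pY[OF piX[OF xc]] by simp
        qed
        then have "d (?pi x) \<in> Q" using B(4) by (auto simp: d_def PiE_UNIV_domain)
        then have "h (d (?pi x)) \<in> ?O" using Q(2) piX[OF xc] by blast
        then have "fst m (?pi x) \<in> ?O" using h(2)[OF piX[OF xc]] by simp
        then show "x \<in> U <#> (\<Inter>n. H n)"
          using open_homomorphism_preimage[OF hom[OF m(1)] Uc xc] Nm N_def by metis
      qed
      then show ?thesis using V by blast
    qed
    have "\<exists>z\<in>carrier G. \<forall>n. z \<in> x n <# H n"
      if x: "\<And>n. x n \<in> carrier G" "\<And>k n. k < n \<Longrightarrow> x n \<in> x k <# H k" for x
    proof -
      have "fst (p k) (?pi (x n)) = fst (p k) (?pi (x k))" if "k < n" for k n
        using x(2)[OF that] N_coset[OF p(1) x(1)[of k] x(1)[of n], of k] p(2)[of k] by simp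
      then obtain z where z: "z \<in> topspace ?X" "\<forall>n. fst (p n) z = fst (p n) (?pi (x n))"
        using strong_sigma_latticeD(4)[OF sL, of p "\<lambda>n. ?pi (x n)"] p(1) fin piX x(1) by blast
      then obtain y where y: "y \<in> carrier G" "z = ?pi y" using topX by auto
      then have "y \<in> x n <# H n" for n
        using z(2) N_coset[OF p(1) x(1)[of n] y(1), of n] p(2)[of n] by simp
      then show ?thesis using y(1) by blast
    qed
    then show ?thesis using top Nm m(1) by blast
  qed
  have "subgroup_lattice K b (N ` L)"
    unfolding subgroup_lattice_def
  proof (intro conjI)
    show "\<forall>H\<in>N ` L. H \<lhd> G \<and> closedin T H \<and> K \<subseteq> H \<and> countable_type b (quotient_base H)"
      using q(1,2) KN countable_type_of_open_homomorphism[OF hom, folded N_def] by blast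
    show "\<forall>U. unit_nhd U \<longrightarrow> (\<exists>H\<in>N ` L. \<exists>V. unit_nhd V \<and> V <#> H \<subseteq> U <#> K)" using nhd by blast
    show "\<forall>H\<in>N ` L. \<forall>H'\<in>N ` L. \<exists>M\<in>N ` L. M \<subseteq> H \<inter> H'"
      using inter by (simp del: Int_subset_iff le_inf_iff)
  next
    show "\<forall>H. range H \<subseteq> N ` L \<and> decseq H \<longrightarrow>
        (\<Inter>n. H n) \<in> N ` L \<and>
        (\<forall>U. unit_nhd U \<longrightarrow> (\<exists>n V. unit_nhd V \<and> V <#> H n \<subseteq> U <#> (\<Inter>n. H n))) \<and>
        (\<forall>x. (\<forall>n. x n \<in> carrier G) \<and> (\<forall>k n. k < n \<longrightarrow> x n \<in> x k <# H k) \<longrightarrow>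
           (\<exists>z\<in>carrier G. \<forall>n. z \<in> x n <# H n))"
      by (intro allI impI, elim conjE, rule seq)
  qed
  then show ?thesis unfolding N_def .
qed

section \<open>From subgroups to open homomorphisms\<close>

abbreviation quotient_mapping :: "'a set \<Rightarrow> ('a, 'a set) mapping" where
  "quotient_mapping N \<equiv> (\<lambda>x. N #> x, quotient_group_topology G T N)"

lemma openin_quotient_image:
  assumes "N \<lhd> G" "openin T U"
  shows "openin (quotient_group_topology G T N) ((\<lambda>x. N #> x) ` U)"
  using open_map_quotient_group[OF assms(1)] assms(2) by (simp add: open_map_def)

text \<open>
  If \<open>x\<inverse> y \<notin> UN\<close> and \<open>W\<close> is a symmetric root of \<open>U\<close>, then \<open>xWN\<close> and \<open>yWN\<close> are disjoint.
\<close>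

lemma Hausdorff_quotient_group:
  assumes N: "N \<lhd> G" "closedin T N"
  shows "Hausdorff_space (quotient_group_topology G T N)"
  unfolding Hausdorff_space_def
proof (intro allI impI, elim conjE)
  interpret N: normal N G by (rule N)
  fix X Y
  assume "X \<in> topspace (quotient_group_topology G T N)" "Y \<in> topspace (quotient_group_topology G T N)" "X \<noteq> Y"
  then obtain x y where xy: "x \<in> carrier G" "X = N #> x" "y \<in> carrier G" "Y = N #> y" "N #> x \<noteq> N #> y"
    by (auto simp: topspace_quotient_group_topology carrier_FactGroup)
  then have "inv x \<otimes> y \<notin> N" using rcos_eq_iff[OF N(1)] by blast
  then have "\<not> (\<forall>U. unit_nhd U \<longrightarrow> inv x \<otimes> y \<in> U <#> N)"
    using closed_subgroup_memI[OF N(2)] xy by blast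
  then obtain U where U: "unit_nhd U" "inv x \<otimes> y \<notin> U <#> N" by blast
  obtain W where W: "unit_nhd W" "W \<subseteq> U" "\<And>x. x \<in> W \<Longrightarrow> inv x \<in> W"
     "\<And>x y. x \<in> W \<Longrightarrow> y \<in> W \<Longrightarrow> x \<otimes> y \<in> U"
    using unit_nhd_symmetric_root[OF U(1)] by blast
  have Wc: "W \<subseteq> carrier G" using unit_nhd_subset[OF W(1)] .
  let ?A = "(\<lambda>x. N #> x) ` (x <# W)" and ?B = "(\<lambda>x. N #> x) ` (y <# W)"
  have "openin (quotient_group_topology G T N) ?A" "openin (quotient_group_topology G T N) ?B"
    using W(1) xy(1,3) open_l_coset openin_quotient_image[OF N(1)] by (simp_all add: unit_nhd_def)
  moreover have "X \<in> ?A" "Y \<in> ?B"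
    using xy W(1) mem_l_coset_iff[OF Wc] by (simp_all add: unit_nhd_def)
  moreover have "disjnt ?A ?B"
  proof (rule ccontr)
    assume "\<not> disjnt ?A ?B"
    then obtain v w where vw: "v \<in> W" "w \<in> W" "N #> (x \<otimes> v) = N #> (y \<otimes> w)"
      by (auto simp: disjnt_def l_coset_def)
    have c: "v \<in> carrier G" "w \<in> carrier G" using vw Wc by auto
    have n: "inv (x \<otimes> v) \<otimes> (y \<otimes> w) \<in> N" using rcos_eq_iff[OF N(1)] vw(3) c xy by simp
    have "v \<otimes> (inv (x \<otimes> v) \<otimes> (y \<otimes> w)) \<in> W <#> N" using set_mult_memI[OF vw(1) n] .
    moreover have "w \<in> W <#> N" using vw(2) subset_set_mult_left[OF N.one_closed Wc] by blast
    ultimately have "v \<otimes> (inv (x \<otimes> v) \<otimes> (y \<otimes> w)) \<otimes> inv w \<in> U <#> N"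
      using set_mult_quotient_closed[OF N(1) Wc] W(3,4) by blast
    moreover have "v \<otimes> (inv (x \<otimes> v) \<otimes> (y \<otimes> w)) \<otimes> inv w = inv x \<otimes> y"
      using c xy by (simp add: group_simps)
    ultimately show False using U(2) by simp
  qed
  ultimately show "\<exists>U V. openin (quotient_group_topology G T N) U \<and> openin (quotient_group_topology G T N) V \<and>
      X \<in> U \<and> Y \<in> V \<and> disjnt U V"
    by blast
qed

lemma topological_group_quotient:
  assumes N: "N \<lhd> G" "closedin T N"
  shows "topological_group (G Mod N) (quotient_group_topology G T N)"
proof -
  interpret N: normal N G by (rule N)
  let ?Q = "quotient_group_topology G T N" and ?pi = "\<lambda>x. N #> x"
  note top = topspace_quotient_group_topology[of N]
  have mult: "continuous_map (prod_topology ?Q ?Q) ?Q (\<lambda>(X, Y). X \<otimes>\<^bsub>G Mod N\<^esub> Y)"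
    unfolding continuous_map_def
  proof (intro conjI allI impI)
    show "(\<lambda>(X, Y). X \<otimes>\<^bsub>G Mod N\<^esub> Y) \<in> topspace (prod_topology ?Q ?Q) \<rightarrow> topspace ?Q"
      using group.is_monoid[OF N.factorgroup_is_group] monoid.m_closed by (fastforce simp: top)
    fix U assume U: "openin ?Q U"
    show "openin (prod_topology ?Q ?Q) {z \<in> topspace (prod_topology ?Q ?Q). (case z of (X, Y) \<Rightarrow> X \<otimes>\<^bsub>G Mod N\<^esub> Y) \<in> U}"
      unfolding openin_prod_topology_alt
    proof (intro allI impI)
      fix X Y assume XY: "(X, Y) \<in> {z \<in> topspace (prod_topology ?Q ?Q). (case z of (X, Y) \<Rightarrow> X \<otimes>\<^bsub>G Mod N\<^esub> Y) \<in> U}"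
      then obtain x y where xy: "x \<in> carrier G" "X = ?pi x" "y \<in> carrier G" "Y = ?pi y"
        by (auto simp: top carrier_FactGroup)
      let ?U = "{x \<in> topspace T. ?pi x \<in> U}"
      have oU: "openin T ?U" using openin_continuous_map_preimage[OF continuous_map_quotient_group U] .
      have "openin (prod_topology T T) {z \<in> topspace (prod_topology T T). (case z of (x, y) \<Rightarrow> x \<otimes> y) \<in> ?U}"
        using openin_continuous_map_preimage[OF continuous_mult oU] .
      moreover have "(x, y) \<in> {z \<in> topspace (prod_topology T T). (case z of (x, y) \<Rightarrow> x \<otimes> y) \<in> ?U}"
        using XY xy N.rcos_sum by (simp add: topspace_eq FactGroup_def)
      ultimately obtain A B where AB: "openin T A" "openin T B" "x \<in> A" "y \<in> B"
        "A \<times> B \<subseteq> {z \<in> topspace (prod_topology T T). (case z of (x, y) \<Rightarrow> x \<otimes> y) \<in> ?U}"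
        unfolding openin_prod_topology_alt by meson
      have "?pi ` A \<times> ?pi ` B \<subseteq> {z \<in> topspace (prod_topology ?Q ?Q). (case z of (X, Y) \<Rightarrow> X \<otimes>\<^bsub>G Mod N\<^esub> Y) \<in> U}"
      proof
        fix z assume "z \<in> ?pi ` A \<times> ?pi ` B"
        then obtain a b where ab: "a \<in> A" "b \<in> B" "z = (?pi a, ?pi b)" by auto
        then have c: "a \<in> carrier G" "b \<in> carrier G" using AB open_subset_carrier by auto
        have "a \<otimes> b \<in> ?U" using AB(5) ab(1,2) by auto
        then show "z \<in> {z \<in> topspace (prod_topology ?Q ?Q). (case z of (X, Y) \<Rightarrow> X \<otimes>\<^bsub>G Mod N\<^esub> Y) \<in> U}"
          using c ab(3) N.rcos_sum[OF c] by (simp add: top carrier_FactGroup)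
      qed
      moreover have "openin ?Q (?pi ` A)" "openin ?Q (?pi ` B)"
        using openin_quotient_image[OF N(1)] AB(1,2) by auto
      moreover have "X \<in> ?pi ` A" "Y \<in> ?pi ` B" using xy AB by auto
      ultimately show "\<exists>A B. openin ?Q A \<and> openin ?Q B \<and> X \<in> A \<and> Y \<in> B \<and>
        A \<times> B \<subseteq> {z \<in> topspace (prod_topology ?Q ?Q). (case z of (X, Y) \<Rightarrow> X \<otimes>\<^bsub>G Mod N\<^esub> Y) \<in> U}"
        by blast
    qed
  qed
  have inv: "continuous_map ?Q ?Q (\<lambda>X. inv\<^bsub>G Mod N\<^esub> X)"
  proof (rule continuous_compose_quotient_map[OF quotient_map_quotient_group_topology[OF topspace_eq]])
    have cont: "continuous_map T ?Q (\<lambda>x. ?pi (inv x))"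
      using continuous_map_compose[OF continuous_inv continuous_map_quotient_group] by (simp add: o_def)
    have pi_inv: "?pi (inv x) = inv\<^bsub>G Mod N\<^esub> (?pi x)" if "x \<in> carrier G" for x
      using that N.inv_FactGroup[of "?pi x"] N.rcos_inv[OF that] by (simp add: carrier_FactGroup)
    show "continuous_map T ?Q ((\<lambda>X. inv\<^bsub>G Mod N\<^esub> X) \<circ> ?pi)"
      by (rule continuous_map_eq[OF cont]) (simp add: pi_inv topspace_eq)
  qed
  show ?thesis
    unfolding topological_group_def topological_group_axioms_def
    using N.factorgroup_is_group top Hausdorff_quotient_group[OF N] mult inv by blast
qed

text \<open>
  The images of the sets witnessing \<open>countable_type\<close> form the network.
\<close>

lemma countable_network_by_quotient:
  assumes N: "N \<lhd> G" and ct: "countable_type b (quotient_base N)"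
  shows "countable_network_by b (quotient_group_topology G T N)"
proof -
  interpret N: normal N G by (rule N)
  let ?Q = "quotient_group_topology G T N" and ?pi = "\<lambda>x. N #> x"
  obtain \<S> where S: "countable \<S>" "b \<longrightarrow> (\<forall>S\<in>\<S>. openin T S)"
    "\<forall>x\<in>carrier G. \<forall>V\<in>quotient_base N. \<exists>S\<in>\<S>. x \<in> S \<and> S \<subseteq> x <# V"
    using ct unfolding countable_type_def by blast
  define \<N> where "\<N> = (\<lambda>S. ?pi ` (S \<inter> carrier G)) ` \<S>"
  have "countable \<N>" unfolding \<N>_def using S(1) by simp
  moreover have "openin ?Q M" if b and M: "M \<in> \<N>" for M
  proof -
    obtain S where "M = ?pi ` (S \<inter> carrier G)" "S \<in> \<S>" using M unfolding \<N>_def by (rule imageE)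
    moreover from this have "openin T (S \<inter> carrier G)"
      using S(2) that(1) topspace_eq by (metis openin_Int openin_topspace)
    ultimately show ?thesis using openin_quotient_image[OF N] by simp
  qed
  moreover have "network ?Q \<N>"
    unfolding network_def
  proof (intro conjI ballI allI impI, goal_cases)
    case (1 M)
    then show ?case by (auto simp: \<N>_def topspace_quotient_group_topology carrier_FactGroup)
  next
    case (2 U X)
    then have U: "openin ?Q U" "X \<in> U" by auto
    then obtain x where x: "x \<in> carrier G" "X = ?pi x"
      using openin_subset[OF U(1)] by (auto simp: topspace_quotient_group_topology carrier_FactGroup)
    let ?U = "{z \<in> carrier G. ?pi z \<in> U}"
    let ?W = "{w \<in> carrier G. x \<otimes> w \<in> ?U}"
    have "openin T ?U"
      using openin_continuous_map_preimage[OF continuous_map_quotient_group U(1)] topspace_eq by simp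
    then have "openin T ?W" by (intro open_preimage continuous_map_left_mult x(1))
    then have "unit_nhd ?W" using x U(2) by (simp add: unit_nhd_def)
    then have "?W <#> N \<in> quotient_base N" by (auto simp: quotient_base_def)
    then obtain S where S': "S \<in> \<S>" "x \<in> S" "S \<subseteq> x <# (?W <#> N)" using S(3) x(1) by meson
    have "?pi ` (S \<inter> carrier G) \<subseteq> U"
    proof
      fix Y assume "Y \<in> ?pi ` (S \<inter> carrier G)"
      then obtain y where y: "y \<in> S" "y \<in> carrier G" "Y = ?pi y" by auto
      then obtain w n where wn: "w \<in> ?W" "n \<in> N" "y = x \<otimes> (w \<otimes> n)"
        using S'(3) unfolding l_coset_def set_mult_def by blast
      then have "inv (x \<otimes> w) \<otimes> y = n" using x(1) N.subset by (simp add: group_simps subset_iff)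
      then have "?pi (x \<otimes> w) = ?pi y"
        using rcos_eq_iff[OF N, of "x \<otimes> w" y] wn(1,2) x(1) y(2) by simp
      then show "Y \<in> U" using wn(1) y(3) by simp
    qed
    moreover have "X \<in> ?pi ` (S \<inter> carrier G)" using S'(2) x by simp
    ultimately show ?case using S'(1) unfolding \<N>_def by blast
  qed
  ultimately show ?thesis unfolding countable_network_by_def by blast
qed

lemma open_homomorphism_quotient_mapping:
  assumes N: "N \<lhd> G" "closedin T N" "countable_type b (quotient_base N)"
  shows "open_homomorphism_onto_group G T (countable_network_by b) (quotient_mapping N)"
proof -
  interpret N: normal N G by (rule N)
  show ?thesis
    unfolding open_homomorphism_onto_group_def prod.case
    using topological_group_quotient[OF N(1,2)] countable_network_by_quotient[OF N(1,3)]
      N.r_coset_hom_Mod carrier_FactGroup[of G N] continuous_map_quotient_group open_map_quotient_group[OF N(1)]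
    by (intro exI[of _ "G Mod N"]) simp
qed

lemma finer_quotient_mapping:
  assumes N: "N \<lhd> G" and M: "M \<lhd> G" and sub: "N \<subseteq> M"
  shows "finer T (quotient_mapping N) (quotient_mapping M)"
proof (rule finer_of_quotient_map[OF quotient_map_quotient_group_topology[OF topspace_eq] continuous_map_quotient_group])
  fix x y assume "x \<in> topspace T" "y \<in> topspace T" "N #> x = N #> y"
  then show "M #> x = M #> y" using rcos_eq_iff[OF N, of x y] rcos_eq_iff[OF M, of x y] sub topspace_eq by auto
qed

lemma finer_quotient_mapping_subset:
  assumes N: "N \<lhd> G" and M: "M \<lhd> G" and fin: "finer T (quotient_mapping N) (quotient_mapping M)"
  shows "N \<subseteq> M"
proof
  interpret N: normal N G by (rule N)
  fix x assume x: "x \<in> N"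
  then have c: "x \<in> carrier G" using N.mem_carrier by blast
  have "N #> \<one> = N #> x" using rcos_eq_iff[OF N one_closed c] x c by simp
  then have "M #> \<one> = M #> x"
    by (rule finer_fibres[OF fin, rotated 2]) (use c topspace_eq in simp_all)
  then show "x \<in> M" using rcos_eq_iff[OF M one_closed c] c by simp
qed

text \<open>
  Here \<open>\<prec>\<close> between quotient mappings is inclusion of subgroups. The delicate point is the diagonal
  product \<open>d\<close> of a decreasing sequence of quotient mappings: the topological clause of
  \<open>subgroup_lattice\<close> says precisely that \<open>d\<close> is open onto its image, so it is the quotient mapping by
  the intersection of the subgroups.
\<close>

lemma strong_sigma_lattice_of_subgroup_lattice:
  assumes L: "subgroup_lattice {\<one>} b \<N>"
  shows "strong_sigma_lattice_of_open_homs G T (countable_network_by b) (quotient_mapping ` \<N>)"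
proof -
  note mem = subgroup_lattice_member[OF L]
  have top: "topspace (quotient_group_topology G T N) = (\<lambda>x. N #> x) ` carrier G" for N
    by (simp add: topspace_quotient_group_topology carrier_FactGroup)
  have onto: "continuous_onto T m" if m: "m \<in> quotient_mapping ` \<N>" for m
  proof -
    obtain N where N: "m = quotient_mapping N" "N \<in> \<N>" using m by (rule imageE)
    then show ?thesis
      unfolding N(1) continuous_onto_def prod.case
      using continuous_map_quotient_group Hausdorff_quotient_group[OF mem(1,2)[OF N(2)]] top topspace_eq by simp
  qed
  have gen: "\<exists>(p, Y)\<in>quotient_mapping ` \<N>. \<exists>V. openin Y V \<and> x \<in> {z \<in> topspace T. p z \<in> V} \<and>
           {z \<in> topspace T. p z \<in> V} \<subseteq> U" if U: "openin T U" "x \<in> U" for U x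
  proof -
    have x: "x \<in> carrier G" using U open_subset_carrier by blast
    let ?W = "{w \<in> carrier G. x \<otimes> w \<in> U}"
    have "unit_nhd ?W"
      using U x open_preimage[OF continuous_map_left_mult[OF x] U(1)] by (simp add: unit_nhd_def)
    then obtain N V where NV: "N \<in> \<N>" "unit_nhd V" "V <#> N \<subseteq> ?W <#> {\<one>}"
      using subgroup_lattice_nhd[OF L] by blast
    have Vc: "V \<subseteq> carrier G" using unit_nhd_subset[OF NV(2)] .
    let ?V = "(\<lambda>x. N #> x) ` (x <# V)"
    have "openin (quotient_group_topology G T N) ?V"
      using openin_quotient_image[OF mem(1)[OF NV(1)]] open_l_coset[OF _ x] NV(2) by (simp add: unit_nhd_def)
    moreover have "x \<in> x <# V" using mem_l_coset_iff[OF Vc x] x NV(2) by (simp add: unit_nhd_def)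
    then have "x \<in> {z \<in> topspace T. N #> z \<in> ?V}" using x topspace_eq by simp
    moreover have "{z \<in> topspace T. N #> z \<in> ?V} \<subseteq> U"
    proof
      fix z assume z: "z \<in> {z \<in> topspace T. N #> z \<in> ?V}"
      then have zc: "z \<in> carrier G" using topspace_eq by simp
      obtain v where v: "v \<in> V" "N #> z = N #> (x \<otimes> v)" using z by (auto simp: l_coset_def)
      have vc: "v \<in> carrier G" using v Vc by blast
      have "inv (x \<otimes> v) \<otimes> z \<in> N" using rcos_eq_iff[OF mem(1)[OF NV(1)], of "x \<otimes> v" z] v(2) x vc zc by simp
      then have "v \<otimes> (inv (x \<otimes> v) \<otimes> z) \<in> ?W <#> {\<one>}" using NV(3) set_mult_memI[OF v(1)] by blast
      then have "inv x \<otimes> z \<in> ?W <#> {\<one>}" using x vc zc by (simp add: group_simps)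
      then have "inv x \<otimes> z \<in> ?W" by (auto simp: set_mult_def)
      then show "z \<in> U" using x zc by (simp add: group_simps)
    qed
    ultimately have "case quotient_mapping N of (p, Y) \<Rightarrow> \<exists>V. openin Y V \<and> x \<in> {z \<in> topspace T. p z \<in> V} \<and>
           {z \<in> topspace T. p z \<in> V} \<subseteq> U"
      unfolding prod.case by blast
    then show ?thesis by (rule bexI) (use NV(1) in simp)
  qed
  have low: "\<exists>M\<in>\<N>. \<forall>N\<in>F. M \<subseteq> N" if "finite F" "F \<subseteq> \<N>" for F
    using that
  proof (induction F)
    case empty
    obtain M V where "M \<in> \<N>" "unit_nhd V" "V <#> M \<subseteq> carrier G <#> {\<one>}"
      using subgroup_lattice_nhd[OF L unit_nhd_carrier] .
    then show ?case by auto
  next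
    case (insert N F)
    then obtain M where M: "M \<in> \<N>" "\<forall>N\<in>F. M \<subseteq> N" by auto
    obtain M' where "M' \<in> \<N>" "M' \<subseteq> M" "M' \<subseteq> N"
      using subgroup_lattice_Int[OF L M(1)] insert.prems by blast
    then show ?case using M(2) by blast
  qed
  have fin: "\<exists>q\<in>quotient_mapping ` \<N>. \<forall>p\<in>F. finer T q p"
    if F: "finite F" "F \<subseteq> quotient_mapping ` \<N>" for F
  proof -
    obtain F' where F': "F' \<subseteq> \<N>" "finite F'" "F = quotient_mapping ` F'" using finite_subset_image[OF F] by blast
    obtain M where M: "M \<in> \<N>" "\<forall>N\<in>F'. M \<subseteq> N" using low[OF F'(2,1)] by blast
    have "finer T (quotient_mapping M) p" if p: "p \<in> F" for p
    proof -
      obtain N where N: "p = quotient_mapping N" "N \<in> F'" using p unfolding F'(3) by (rule imageE)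
      then show ?thesis using finer_quotient_mapping[OF mem(1)[OF M(1)] mem(1)] M(2) F'(1) by blast
    qed
    then show ?thesis using M(1) by blast
  qed
  have seq: "(\<exists>q\<in>quotient_mapping ` \<N>. finer T q (diagonal_product T p) \<and> finer T (diagonal_product T p) q) \<and>
        (\<forall>x. (\<forall>n. x n \<in> topspace T) \<and> (\<forall>k n. k < n \<longrightarrow> fst (p k) (x n) = fst (p k) (x k)) \<longrightarrow>
           (\<exists>z\<in>topspace T. \<forall>n. fst (p n) z = fst (p n) (x n)))"
    if p: "\<forall>n. p n \<in> quotient_mapping ` \<N>" "\<forall>n. finer T (p (Suc n)) (p n)" for p
  proof -
    have "\<exists>N. N \<in> \<N> \<and> p n = quotient_mapping N" for n using p(1) by blast
    then obtain N where N: "\<And>n. N n \<in> \<N>" "\<And>n. p n = quotient_mapping (N n)" by metis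
    note nN = mem(1)[OF N(1)]
    have "N (Suc n) \<subseteq> N n" for n
      using finer_quotient_mapping_subset[OF nN nN] p(2) unfolding N(2) by blast
    then have dec: "decseq N" by (simp add: decseq_Suc_iff)
    let ?M = "\<Inter>n. N n"
    have M: "?M \<in> \<N>" using subgroup_lattice_decseq(1)[OF L N(1) dec] .
    note nM = mem(1)[OF M]
    define d where "d = (\<lambda>x n. N n #> x)"
    define D where "D = subtopology (product_topology (\<lambda>n. quotient_group_topology G T (N n)) UNIV) (d ` topspace T)"
    have dp: "diagonal_product T p = (d, D)" by (simp add: diagonal_product_def d_def D_def Let_def N(2))
    have topD: "topspace D = d ` carrier G"
      unfolding D_def topspace_subtopology topspace_product_topology top topspace_eq
      by (auto simp: d_def PiE_UNIV_domain)
    have M_eq: "?M #> x = ?M #> y \<longleftrightarrow> d x = d y" if "x \<in> carrier G" "y \<in> carrier G" for x y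
      using rcos_eq_iff[OF nM that] rcos_eq_iff[OF nN that] by (simp add: d_def fun_eq_iff)
    have contd: "continuous_map T D d"
      unfolding D_def continuous_map_in_subtopology continuous_map_componentwise_UNIV
      using continuous_map_quotient_group by (simp add: d_def)
    have fd: "finer T (quotient_mapping ?M) (d, D)"
      by (rule finer_of_quotient_map[OF quotient_map_quotient_group_topology[OF topspace_eq] contd])
        (use M_eq topspace_eq in auto)
    have "open_map T D d"
      unfolding open_map_def
    proof (intro allI impI)
      fix U assume U: "openin T U"
      have Uc: "U \<subseteq> carrier G" using open_subset_carrier[OF U] .
      have "\<exists>S. openin D S \<and> f \<in> S \<and> S \<subseteq> d ` U" if f: "f \<in> d ` U" for f
      proof -
        obtain u where u: "f = d u" "u \<in> U" using f by (rule imageE)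
        have uc: "u \<in> carrier G" using u(2) Uc by blast
        let ?W = "{w \<in> carrier G. u \<otimes> w \<in> U}"
        have "unit_nhd ?W"
          using U u(2) uc open_preimage[OF continuous_map_left_mult[OF uc] U] by (simp add: unit_nhd_def)
        then obtain n V where V: "unit_nhd V" "V <#> N n \<subseteq> ?W <#> ?M"
          using subgroup_lattice_decseq(2)[OF L N(1) dec] by meson
        have Vc: "V \<subseteq> carrier G" using unit_nhd_subset[OF V(1)] .
        let ?V = "(\<lambda>x. N n #> x) ` (u <# V)"
        let ?S = "{f \<in> topspace D. f n \<in> ?V}"
        have "openin (quotient_group_topology G T (N n)) ?V"
          using openin_quotient_image[OF nN] open_l_coset[OF _ uc] V(1) by (simp add: unit_nhd_def)
        moreover have "continuous_map D (quotient_group_topology G T (N n)) (\<lambda>f. f n)"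
          unfolding D_def by (intro continuous_map_from_subtopology continuous_map_product_projection) simp
        ultimately have "openin D ?S" using openin_continuous_map_preimage by blast
        moreover have "u \<in> u <# V" using mem_l_coset_iff[OF Vc uc] uc V(1) by (simp add: unit_nhd_def)
        then have "f \<in> ?S" unfolding u(1) topD using uc by (simp add: d_def)
        moreover have "?S \<subseteq> d ` U"
        proof
          fix g assume g: "g \<in> ?S"
          then obtain y where y: "g = d y" "y \<in> carrier G" unfolding topD by blast
          obtain v where v: "v \<in> V" "N n #> y = N n #> (u \<otimes> v)" using g unfolding y(1) by (auto simp: l_coset_def d_def)
          have vc: "v \<in> carrier G" using v Vc by blast
          have "inv (u \<otimes> v) \<otimes> y \<in> N n" using rcos_eq_iff[OF nN, of "u \<otimes> v" y n] v(2) uc vc y(2) by simp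
          then have "v \<otimes> (inv (u \<otimes> v) \<otimes> y) \<in> ?W <#> ?M" using V(2) set_mult_memI[OF v(1)] by blast
          then have "inv u \<otimes> y \<in> ?W <#> ?M" using uc vc y(2) by (simp add: group_simps)
          then obtain w m where wm: "w \<in> ?W" "m \<in> ?M" "inv u \<otimes> y = w \<otimes> m" by (rule set_mult_memE)
          have wc: "w \<in> carrier G" "m \<in> carrier G"
            using wm(1,2) subgroup.subset[OF normal_imp_subgroup[OF nM]] by auto
          have "y = u \<otimes> (inv u \<otimes> y)" using uc y(2) by (simp add: group_simps)
          then have "y = (u \<otimes> w) \<otimes> m" unfolding wm(3) using uc wc by (simp add: m_assoc)
          then have "inv (u \<otimes> w) \<otimes> y = m" using uc wc by (simp add: group_simps)
          then have "?M #> (u \<otimes> w) = ?M #> y" using rcos_eq_iff[OF nM, of "u \<otimes> w" y] uc wc(1) y(2) wm(2) by simp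
          then have "g = d (u \<otimes> w)" using M_eq[of "u \<otimes> w" y] uc wc(1) y by simp
          then show "g \<in> d ` U" using wm(1) by blast
        qed
        ultimately show ?thesis by blast
      qed
      then show "openin D (d ` U)" using openin_subopen[of D "d ` U"] by blast
    qed
    then have quot_d: "quotient_map T D d"
      using contd topD topspace_eq by (intro continuous_open_imp_quotient_map) simp_all
    have df: "finer T (d, D) (quotient_mapping ?M)"
      by (rule finer_of_quotient_map[OF quot_d continuous_map_quotient_group]) (use M_eq topspace_eq in auto)
    have "\<exists>z\<in>topspace T. \<forall>n. fst (p n) z = fst (p n) (x n)"
      if x: "\<And>n. x n \<in> topspace T" "\<And>k n. k < n \<Longrightarrow> fst (p k) (x n) = fst (p k) (x k)" for x
    proof -
      have xc: "x n \<in> carrier G" for n using x(1) topspace_eq by simp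
      have c: "N n \<subseteq> carrier G" for n using normal_imp_subgroup[OF nN] subgroup.subset by blast
      have eq: "N k #> y = N k #> z \<longleftrightarrow> z \<in> y <# N k" if "y \<in> carrier G" "z \<in> carrier G" for k y z
        using rcos_eq_iff[OF nN that] mem_l_coset_iff[OF c that(1)] that(2) by simp
      have xk: "x n \<in> x k <# N k" if "k < n" for k n
        using eq[OF xc xc, of k k n] x(2)[OF that] by (simp add: N(2))
      obtain z where z: "z \<in> carrier G" "\<forall>n. z \<in> x n <# N n"
        using subgroup_lattice_decseq(3)[OF L N(1) dec xc xk] by meson
      then have "fst (p n) z = fst (p n) (x n)" for n using eq[OF xc z(1), of n n] by (simp add: N(2))
      then show ?thesis using z(1) topspace_eq by blast
    qed
    then show ?thesis using fd df M unfolding dp by blast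
  qed
  have "strong_sigma_lattice T (quotient_mapping ` \<N>)"
    unfolding strong_sigma_lattice_def
  proof (rule conjI[OF _ conjI[OF _ conjI]], goal_cases)
    case 1 show ?case by (rule ballI) (rule onto)
  next
    case 2 show ?case by (intro allI impI, elim conjE) (rule gen)
  next
    case 3 show ?case by (intro allI impI, elim conjE) (rule fin)
  next
    case 4 show ?case by (intro allI impI, elim conjE) (rule seq)
  qed
  moreover have "open_homomorphism_onto_group G T (countable_network_by b) m" if m: "m \<in> quotient_mapping ` \<N>" for m
  proof -
    obtain N where N: "m = quotient_mapping N" "N \<in> \<N>" using m by (rule imageE)
    show ?thesis unfolding N(1) using open_homomorphism_quotient_mapping[OF mem(1,2,4)[OF N(2)]] .
  qed
  ultimately show ?thesis unfolding strong_sigma_lattice_of_open_homs_def by blast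
qed

lemma strong_sigma_lattice_of_compact_extension:
  assumes K: "K \<lhd> G" "compactin T K"
    and L: "\<exists>L :: ('a set, 'c) mapping set. strong_sigma_lattice_of_open_homs (G Mod K)
      (quotient_group_topology G T K) (countable_network_by b) L"
  shows "\<exists>L :: ('a, 'a set) mapping set. strong_sigma_lattice_of_open_homs G T (countable_network_by b) L"
proof -
  obtain L :: "('a set, 'c) mapping set" where "strong_sigma_lattice_of_open_homs (G Mod K)
      (quotient_group_topology G T K) (countable_network_by b) L"
    using L by blast
  from strong_sigma_lattice_of_subgroup_lattice[OF subgroup_lattice_compact_lift[OF
      subgroup_lattice_of_strong_sigma_lattice[OF K(1) this] K]]
  show ?thesis by blast
qed

end

theorem theorem3p11:
  fixes G :: "('a, 'm) monoid_scheme" and T :: "'a topology" and K :: "'a set"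
  assumes "topological_group G T"
    and "K \<lhd> G"
    and "compactin T K"
  shows
    "((\<exists>L :: ('a set, 'c) mapping set.
         strong_sigma_lattice_of_open_homs (G Mod K) (quotient_group_topology G T K)
           has_countable_network L) \<longrightarrow>
      (\<exists>L :: ('a, 'a set) mapping set.
         strong_sigma_lattice_of_open_homs G T has_countable_network L)) \<and>
     ((\<exists>L :: ('a set, 'd) mapping set.
         strong_sigma_lattice_of_open_homs (G Mod K) (quotient_group_topology G T K)
           second_countable L) \<longrightarrow>
      (\<exists>L :: ('a, 'a set) mapping set.
         strong_sigma_lattice_of_open_homs G T second_countable L))"
  using topological_group.strong_sigma_lattice_of_compact_extension[OF assms, of False]
    topological_group.strong_sigma_lattice_of_compact_extension[OF assms, of True]
  unfolding countable_network_by_False countable_network_by_True by blast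

end
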